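(* Let $L$ be any description logic whose TBoxes are sets of normalized Horn-$\mathcal{ALCHOI}$ rules, and let $\mathfrak{m}\in\{\mathfrak{m}_s,\mathfrak{m}_t,\mathfrak{m}_d\}$. For every fixed $L$-TBox $\mathcal{T}$, every fixed Boolean CQ $q$ and every fixed natural number $n$, the following problem is in $\mathsf{AC^0}$ (data complexity): given an ABox $\mathcal{A}$ with $\mathcal{T}\cup\mathcal{A}\models q$, decide whether there is a proof $p$ for $q$ in $\mathfrak{R}_{sk}(\mathcal{T}^s\cup\mathcal{A},q)$ with $\mathfrak{m}(p)\le n$.
   Context: Concept names, role names and individual names are pairwise disjoint; a role is a role name $r$ or an inverse $r^-$, where $r^-(x,y)$ stands for $r(y,x)$. A (normalized) Horn-$\mathcal{ALCHOI}$ TBox is a finite set of rules of the forms (i) $A(x)\to B(x)$, (ii) $A(x)\land B(x)\to C(x)$, (iii) $R(x,y)\land A(y)\to B(x)$, (iv) $A(x)\to\exists y.\,R(x,y)\land B(y)$, (v) $A(x)\land R(x,y)\to B(y)$, (vi) $A(x)\to x=a$, (vii) $R_1(x,y)\to R_2(x,y)$, with $A,B,C$ concept names or $\top$, $a$ an individual name, $R,R_1,R_2$ roles ($\bot$ is not used). An ABox is a finite set of facts $A(a)$, $r(a,b)$. A Boolean CQ is $\exists\vec y.\,\phi(\vec y)$ with $\phi$ a conjunction of atoms $A(t)$, $r(s,t)$ whose terms are variables from $\vec y$ or individual names; $\mathcal{T}\cup\mathcal{A}\models q$ means every first-order model of $\mathcal{T}\cup\mathcal{A}$ satisfies $q$.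 The Skolemization $\mathcal{T}^s$ replaces every rule $A(x)\to\exists y.\,R(x,y)\land B(y)$ by $A(x)\to R(x,f(x))\land B(f(x))$ with a fresh unary function symbol $f$ per rule; ground terms are built from individual names and these function symbols. A derivation structure over a theory $\mathcal{U}$ is a directed labeled hypergraph $(V,E,\ell)$ with hyperedges (inferences) $(S,d)$, $S\subseteq V$ finite, $d\in V$, such that every leaf (vertex without incoming hyperedge) is labeled by an element of $\mathcal{U}$ and every inference is sound ($\{\ell(s)\mid s\in S\}\models\ell(d)$). A proof of $\mathcal{U}\models\eta$ is a finite derivation structure that is acyclic, has exactly one sink, labeled $\eta$, and in which each vertex has at most one incoming hyperedge. Measures: size $\mathfrak{m}_s(p)$ = number of vertices; tree size $\mathfrak{m}_t(p)$ = number of vertices of the tree unravelling at the sink (recursively: 1 for a leaf, $1+\sum_{v\in S}\mathfrak{m}_t(v)$ for a vertex with incoming $(S,d)$); domain size $\mathfrak{m}_d(p)$ = number of distinct ground terms occurring in labels of $p$. $\mathfrak{R}_{sk}(\mathcal{T}^s\cup\mathcal{A},q)$ is the (possibly infinite) derivation structure whose vertices are labeled by rules of $\mathcal{T}^s$, facts of $\mathcal{A}$, ground atoms (including ground equalities $t_1=t_2$), conjunctions of ground atoms, and $q$, with all inferences of the forms: (MP) from ground atoms $\alpha_1,\dots,\alpha_k$ and a rule $\psi\to\chi\in\mathcal{T}^s$ such that for a substitution $\sigma$ of the rule's variables by ground terms $\sigma(\psi)=\{\alpha_1,\dots,\alpha_k\}$, infer any single atom of $\sigma(\chi)$; (E)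 from a ground atom $\alpha$ and $t_1=t_2$ infer $\alpha[t_1\mapsto t_2]$; (C) from ground atoms $\alpha_1,\dots,\alpha_k$ infer $\alpha_1\land\dots\land\alpha_k$; (G) from a conjunction $\gamma$ of ground atoms infer the Boolean CQ $q$ if some mapping of the variables of $q$ to ground terms maps every atom of $q$ to an atom of $\gamma$. A proof for $q$ in $\mathfrak{R}_{sk}(\mathcal{T}^s\cup\mathcal{A},q)$ is a proof of $\mathcal{T}^s\cup\mathcal{A}\models q$ all of whose inferences are inferences of this structure. *)

theory Defs
  imports Main
begin

section \<open>Syntax\<close>

text \<open>Names are words over the binary alphabet. Concept, role and individual names are kept apart
  by the constructors they occur under.\<close>

type_synonym name = "bool list"

datatype role = Role name | Inv name

datatype conc = Top | Name name

datatype axiom =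
    Sub conc conc                \<comment> \<open>\<open>A(x) \<rightarrow> B(x)\<close>\<close>
  | SubConj conc conc conc       \<comment> \<open>\<open>A(x) \<and> B(x) \<rightarrow> C(x)\<close>\<close>
  | ExLeft role conc conc        \<comment> \<open>\<open>R(x,y) \<and> A(y) \<rightarrow> B(x)\<close>\<close>
  | ExRight conc role conc       \<comment> \<open>\<open>A(x) \<rightarrow> \<exists>y. R(x,y) \<and> B(y)\<close>\<close>
  | AllRight conc role conc      \<comment> \<open>\<open>A(x) \<and> R(x,y) \<rightarrow> B(y)\<close>\<close>
  | Nominal conc name            \<comment> \<open>\<open>A(x) \<rightarrow> x = a\<close>\<close>
  | SubRole role role            \<comment> \<open>\<open>R\<^sub>1(x,y) \<rightarrow> R\<^sub>2(x,y)\<close>\<close>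

type_synonym tbox = "axiom set"

text \<open>The fresh Skolem function symbol of an existential axiom is the axiom itself.\<close>

datatype trm = Var nat | Const name | Fun axiom trm

datatype atom = CAtom name trm | RAtom name trm trm | EqAtom trm trm

text \<open>The sentences that label proofs. \<open>Clause B H\<close> is the universal closure of
  \<open>\<And>B \<rightarrow> \<And>H\<close>, and \<open>CQ as\<close> is the existential closure of \<open>\<And>as\<close>. Thus \<open>CQ [\<alpha>]\<close> with ground
  \<open>\<alpha>\<close> is the ground atom \<open>\<alpha>\<close>, and \<open>CQ as\<close> with ground \<open>as\<close> is a conjunction of ground atoms.\<close>

datatype sentence = Clause "atom list" "atom list" | CQ "atom list"

datatype fact = CFact name name | RFact name name name

type_synonym abox = "fact set"

fun fact_sentence :: "fact \<Rightarrow> sentence" where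
  "fact_sentence (CFact A a) = CQ [CAtom A (Const a)]"
| "fact_sentence (RFact r a b) = CQ [RAtom r (Const a) (Const b)]"

fun simple_term :: "trm \<Rightarrow> bool" where
  "simple_term (Var x) = True"
| "simple_term (Const a) = True"
| "simple_term (Fun f t) = False"

fun query_atom :: "atom \<Rightarrow> bool" where
  "query_atom (CAtom A t) = simple_term t"
| "query_atom (RAtom r s t) = (simple_term s \<and> simple_term t)"
| "query_atom (EqAtom s t) = False"

definition boolean_cq :: "atom list \<Rightarrow> bool" where
  "boolean_cq q \<longleftrightarrow> q \<noteq> [] \<and> (\<forall>\<alpha>\<in>set q. query_atom \<alpha>)"


section \<open>First-order semantics\<close>

record 'd interp =
  univ :: "'d set"
  cint :: "name \<Rightarrow> 'd set"
  rint :: "name \<Rightarrow> ('d \<times> 'd) set"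
  iint :: "name \<Rightarrow> 'd"
  fint :: "axiom \<Rightarrow> 'd \<Rightarrow> 'd"

definition is_interp :: "'d interp \<Rightarrow> bool" where
  "is_interp I \<longleftrightarrow> univ I \<noteq> {} \<and> range (iint I) \<subseteq> univ I \<and>
     (\<forall>f. \<forall>d\<in>univ I. fint I f d \<in> univ I)"

primrec term_val :: "'d interp \<Rightarrow> (nat \<Rightarrow> 'd) \<Rightarrow> trm \<Rightarrow> 'd" where
  "term_val I v (Var x) = v x"
| "term_val I v (Const a) = iint I a"
| "term_val I v (Fun f t) = fint I f (term_val I v t)"

primrec sat_atom :: "'d interp \<Rightarrow> (nat \<Rightarrow> 'd) \<Rightarrow> atom \<Rightarrow> bool" where
  "sat_atom I v (CAtom A t) \<longleftrightarrow> term_val I v t \<in> cint I A"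
| "sat_atom I v (RAtom r s t) \<longleftrightarrow> (term_val I v s, term_val I v t) \<in> rint I r"
| "sat_atom I v (EqAtom s t) \<longleftrightarrow> term_val I v s = term_val I v t"

primrec sat :: "'d interp \<Rightarrow> sentence \<Rightarrow> bool" where
  "sat I (Clause B H) \<longleftrightarrow> (\<forall>v. range v \<subseteq> univ I \<longrightarrow>
     (\<forall>\<alpha>\<in>set B. sat_atom I v \<alpha>) \<longrightarrow> (\<forall>\<alpha>\<in>set H. sat_atom I v \<alpha>))"
| "sat I (CQ as) \<longleftrightarrow> (\<exists>v. range v \<subseteq> univ I \<and> (\<forall>\<alpha>\<in>set as. sat_atom I v \<alpha>))"

fun sat_conc :: "'d interp \<Rightarrow> conc \<Rightarrow> 'd \<Rightarrow> bool" where
  "sat_conc I Top d = True"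
| "sat_conc I (Name A) d = (d \<in> cint I A)"

fun sat_role :: "'d interp \<Rightarrow> role \<Rightarrow> 'd \<Rightarrow> 'd \<Rightarrow> bool" where
  "sat_role I (Role r) d e = ((d, e) \<in> rint I r)"
| "sat_role I (Inv r) d e = ((e, d) \<in> rint I r)"

fun sat_axiom :: "'d interp \<Rightarrow> axiom \<Rightarrow> bool" where
  "sat_axiom I (Sub A B) = (\<forall>d\<in>univ I. sat_conc I A d \<longrightarrow> sat_conc I B d)"
| "sat_axiom I (SubConj A B C) =
     (\<forall>d\<in>univ I. sat_conc I A d \<and> sat_conc I B d \<longrightarrow> sat_conc I C d)"
| "sat_axiom I (ExLeft R A B) =
     (\<forall>d\<in>univ I. \<forall>e\<in>univ I. sat_role I R d e \<and> sat_conc I A e \<longrightarrow> sat_conc I B d)"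
| "sat_axiom I (ExRight A R B) =
     (\<forall>d\<in>univ I. sat_conc I A d \<longrightarrow> (\<exists>e\<in>univ I. sat_role I R d e \<and> sat_conc I B e))"
| "sat_axiom I (AllRight A R B) =
     (\<forall>d\<in>univ I. \<forall>e\<in>univ I. sat_conc I A d \<and> sat_role I R d e \<longrightarrow> sat_conc I B e)"
| "sat_axiom I (Nominal A a) = (\<forall>d\<in>univ I. sat_conc I A d \<longrightarrow> d = iint I a)"
| "sat_axiom I (SubRole R S) =
     (\<forall>d\<in>univ I. \<forall>e\<in>univ I. sat_role I R d e \<longrightarrow> sat_role I S d e)"

text \<open>Entailment cannot quantify over all types of domain elements. The sets of sentences used
  below are finite, so by the downward Loewenheim-Skolem theorem it is enough to
  consider models whose domain is a nonempty set of natural numbers.\<close>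

definition entails :: "sentence set \<Rightarrow> sentence \<Rightarrow> bool" where
  "entails \<Gamma> \<phi> \<longleftrightarrow>
     (\<forall>I :: nat interp. is_interp I \<longrightarrow> (\<forall>\<psi>\<in>\<Gamma>. sat I \<psi>) \<longrightarrow> sat I \<phi>)"

definition kb_entails :: "tbox \<Rightarrow> abox \<Rightarrow> atom list \<Rightarrow> bool" where
  "kb_entails T A q \<longleftrightarrow>
     (\<forall>I :: nat interp. is_interp I \<longrightarrow> (\<forall>\<rho>\<in>T. sat_axiom I \<rho>) \<longrightarrow>
        (\<forall>\<phi>\<in>A. sat I (fact_sentence \<phi>)) \<longrightarrow> sat I (CQ q))"


section \<open>Skolemization\<close>

text \<open>As \<open>\<top>\<close> is a logical constant and not a concept name, \<open>\<top>(t)\<close> is the empty conjunction.\<close>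

fun conc_atoms :: "conc \<Rightarrow> trm \<Rightarrow> atom list" where
  "conc_atoms Top t = []"
| "conc_atoms (Name A) t = [CAtom A t]"

fun role_atoms :: "role \<Rightarrow> trm \<Rightarrow> trm \<Rightarrow> atom list" where
  "role_atoms (Role r) s t = [RAtom r s t]"
| "role_atoms (Inv r) s t = [RAtom r t s]"

abbreviation "vx \<equiv> Var 0"
abbreviation "vy \<equiv> Var 1"

fun skolem :: "axiom \<Rightarrow> sentence" where
  "skolem (Sub A B) = Clause (conc_atoms A vx) (conc_atoms B vx)"
| "skolem (SubConj A B C) = Clause (conc_atoms A vx @ conc_atoms B vx) (conc_atoms C vx)"
| "skolem (ExLeft R A B) = Clause (role_atoms R vx vy @ conc_atoms A vy) (conc_atoms B vx)"
| "skolem (ExRight A R B) = (let t = Fun (ExRight A R B) vx in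
     Clause (conc_atoms A vx) (role_atoms R vx t @ conc_atoms B t))"
| "skolem (AllRight A R B) = Clause (conc_atoms A vx @ role_atoms R vx vy) (conc_atoms B vy)"
| "skolem (Nominal A a) = Clause (conc_atoms A vx) [EqAtom vx (Const a)]"
| "skolem (SubRole R S) = Clause (role_atoms R vx vy) (role_atoms S vx vy)"

definition skolem_theory :: "tbox \<Rightarrow> abox \<Rightarrow> sentence set" where
  "skolem_theory T A = skolem ` T \<union> fact_sentence ` A"

fun existential :: "axiom \<Rightarrow> bool" where
  "existential (ExRight A R B) = True"
| "existential _ = False"

primrec ground_term :: "tbox \<Rightarrow> trm \<Rightarrow> bool" where
  "ground_term T (Var x) = False"
| "ground_term T (Const a) = True"
| "ground_term T (Fun f t) = (f \<in> T \<and> existential f \<and> ground_term T t)"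

primrec map_atom_terms :: "(trm \<Rightarrow> trm) \<Rightarrow> atom \<Rightarrow> atom" where
  "map_atom_terms h (CAtom A t) = CAtom A (h t)"
| "map_atom_terms h (RAtom r s t) = RAtom r (h s) (h t)"
| "map_atom_terms h (EqAtom s t) = EqAtom (h s) (h t)"

primrec atom_terms :: "atom \<Rightarrow> trm set" where
  "atom_terms (CAtom A t) = {t}"
| "atom_terms (RAtom r s t) = {s, t}"
| "atom_terms (EqAtom s t) = {s, t}"

definition ground_atom :: "tbox \<Rightarrow> atom \<Rightarrow> bool" where
  "ground_atom T \<alpha> \<longleftrightarrow> (\<forall>t\<in>atom_terms \<alpha>. ground_term T t)"

primrec subst_term :: "(nat \<Rightarrow> trm) \<Rightarrow> trm \<Rightarrow> trm" where
  "subst_term \<sigma> (Var x) = \<sigma> x"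
| "subst_term \<sigma> (Const a) = Const a"
| "subst_term \<sigma> (Fun f t) = Fun f (subst_term \<sigma> t)"

abbreviation subst_atom :: "(nat \<Rightarrow> trm) \<Rightarrow> atom \<Rightarrow> atom" where
  "subst_atom \<sigma> \<equiv> map_atom_terms (subst_term \<sigma>)"

text \<open>\<open>replace_term s t u\<close> is \<open>u[s \<mapsto> t]\<close>; nested occurrences are replaced as well.\<close>

fun replace_term :: "trm \<Rightarrow> trm \<Rightarrow> trm \<Rightarrow> trm" where
  "replace_term s t (Fun f u) = (if Fun f u = s then t else Fun f (replace_term s t u))"
| "replace_term s t u = (if u = s then t else u)"


section \<open>Derivation structures and proofs\<close>

record ('v, 'l) dstruct =
  verts :: "'v set"
  infs :: "('v set \<times> 'v) set"
  lab :: "'v \<Rightarrow> 'l"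

definition leaf :: "('v, 'l) dstruct \<Rightarrow> 'v \<Rightarrow> bool" where
  "leaf D v \<longleftrightarrow> v \<in> verts D \<and> (\<nexists>S. (S, v) \<in> infs D)"

definition sink :: "('v, 'l) dstruct \<Rightarrow> 'v \<Rightarrow> bool" where
  "sink D v \<longleftrightarrow> v \<in> verts D \<and> (\<nexists>S d. (S, d) \<in> infs D \<and> v \<in> S)"

definition step_rel :: "('v, 'l) dstruct \<Rightarrow> ('v \<times> 'v) set" where
  "step_rel D = {(s, d). \<exists>S. (S, d) \<in> infs D \<and> s \<in> S}"

definition derivation_structure :: "sentence set \<Rightarrow> ('v, sentence) dstruct \<Rightarrow> bool" where
  "derivation_structure U D \<longleftrightarrow>
     (\<forall>(S, d) \<in> infs D. S \<subseteq> verts D \<and> finite S \<and> d \<in> verts D \<and> entails (lab D ` S) (lab D d)) \<and>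
     (\<forall>v. leaf D v \<longrightarrow> lab D v \<in> U)"

definition proof_of :: "sentence set \<Rightarrow> sentence \<Rightarrow> ('v, sentence) dstruct \<Rightarrow> bool" where
  "proof_of U \<eta> p \<longleftrightarrow>
     derivation_structure U p \<and> finite (verts p) \<and> finite (infs p) \<and> acyclic (step_rel p) \<and>
     (\<exists>!v. sink p v) \<and> (\<forall>v. sink p v \<longrightarrow> lab p v = \<eta>) \<and>
     (\<forall>d S S'. (S, d) \<in> infs p \<longrightarrow> (S', d) \<in> infs p \<longrightarrow> S = S')"

definition size_measure :: "('v, sentence) dstruct \<Rightarrow> nat" where
  "size_measure p = card (verts p)"

text \<open>In a proof the predecessors of a vertex are the premises of its only incoming inference.\<close>

definition vertex_tree_size :: "('v, 'l) dstruct \<Rightarrow> 'v \<Rightarrow> nat" where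
  "vertex_tree_size D =
     wfrec (step_rel D) (\<lambda>rec v. 1 + (\<Sum>s | (s, v) \<in> step_rel D. rec s))"

definition tree_measure :: "('v, sentence) dstruct \<Rightarrow> nat" where
  "tree_measure p = vertex_tree_size p (THE v. sink p v)"

primrec term_vars :: "trm \<Rightarrow> nat set" where
  "term_vars (Var x) = {x}"
| "term_vars (Const a) = {}"
| "term_vars (Fun f t) = term_vars t"

primrec subterms :: "trm \<Rightarrow> trm set" where
  "subterms (Var x) = {Var x}"
| "subterms (Const a) = {Const a}"
| "subterms (Fun f t) = insert (Fun f t) (subterms t)"

primrec sentence_atoms :: "sentence \<Rightarrow> atom set" where
  "sentence_atoms (Clause B H) = set B \<union> set H"
| "sentence_atoms (CQ as) = set as"

definition ground_terms_in :: "sentence \<Rightarrow> trm set" where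
  "ground_terms_in \<phi> =
     {t. \<exists>\<alpha>\<in>sentence_atoms \<phi>. \<exists>u\<in>atom_terms \<alpha>. t \<in> subterms u \<and> term_vars t = {}}"

definition domain_measure :: "('v, sentence) dstruct \<Rightarrow> nat" where
  "domain_measure p = card (\<Union>v\<in>verts p. ground_terms_in (lab p v))"

inductive_set sk_inferences :: "tbox \<Rightarrow> atom list \<Rightarrow> (sentence set \<times> sentence) set"
  for T :: tbox and q :: "atom list" where
  MP: "\<lbrakk> Clause B H \<in> skolem ` T; \<forall>x. ground_term T (\<sigma> x); \<beta> \<in> subst_atom \<sigma> ` set H \<rbrakk> \<Longrightarrow>
       (insert (Clause B H) ((\<lambda>\<alpha>. CQ [subst_atom \<sigma> \<alpha>]) ` set B), CQ [\<beta>]) \<in> sk_inferences T q"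
| E: "\<lbrakk> ground_atom T \<alpha>; ground_term T s; ground_term T t \<rbrakk> \<Longrightarrow>
       ({CQ [\<alpha>], CQ [EqAtom s t]}, CQ [map_atom_terms (replace_term s t) \<alpha>])
         \<in> sk_inferences T q"
| C: "\<lbrakk> as \<noteq> []; \<forall>\<alpha>\<in>set as. ground_atom T \<alpha> \<rbrakk> \<Longrightarrow>
       ((\<lambda>\<alpha>. CQ [\<alpha>]) ` set as, CQ as) \<in> sk_inferences T q"
| G: "\<lbrakk> as \<noteq> []; \<forall>\<alpha>\<in>set as. ground_atom T \<alpha>;
        \<forall>x. ground_term T (\<sigma> x); subst_atom \<sigma> ` set q \<subseteq> set as \<rbrakk> \<Longrightarrow>
       ({CQ as}, CQ q) \<in> sk_inferences T q"

definition sk_proof :: "tbox \<Rightarrow> abox \<Rightarrow> atom list \<Rightarrow> ('v, sentence) dstruct \<Rightarrow> bool" where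
  "sk_proof T A q p \<longleftrightarrow> proof_of (skolem_theory T A) (CQ q) p \<and>
     (\<forall>(S, d) \<in> infs p. (lab p ` S, lab p d) \<in> sk_inferences T q)"


section \<open>The circuit class \<open>AC\<^sup>0\<close>\<close>

text \<open>An empty conjunction or disjunction provides a constant gate.\<close>

datatype gate = InputG nat | NotG | AndG | OrG

record 'g circuit =
  gates :: "'g set"
  kind :: "'g \<Rightarrow> gate"
  wires :: "('g \<times> 'g) set"
  outgate :: 'g

definition circuit_depth_le :: "'g circuit \<Rightarrow> nat \<Rightarrow> bool" where
  "circuit_depth_le C d \<longleftrightarrow> wires C ^^ Suc d = {}"

definition wf_circuit :: "nat \<Rightarrow> 'g circuit \<Rightarrow> bool" where
  "wf_circuit m C \<longleftrightarrow> finite (gates C) \<and> wires C \<subseteq> gates C \<times> gates C \<and> acyclic (wires C) \<and>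
     outgate C \<in> gates C \<and>
     (\<forall>g\<in>gates C. case kind C g of
        InputG i \<Rightarrow> i < m \<and> (\<nexists>h. (h, g) \<in> wires C)
      | NotG \<Rightarrow> \<exists>!h. (h, g) \<in> wires C
      | _ \<Rightarrow> True)"

definition gate_valuation :: "'g circuit \<Rightarrow> bool list \<Rightarrow> ('g \<Rightarrow> bool) \<Rightarrow> bool" where
  "gate_valuation C w v \<longleftrightarrow> (\<forall>g\<in>gates C. v g =
     (case kind C g of
        InputG i \<Rightarrow> w ! i
      | NotG \<Rightarrow> \<not> (\<exists>h. (h, g) \<in> wires C \<and> v h)
      | AndG \<Rightarrow> \<forall>h. (h, g) \<in> wires C \<longrightarrow> v h
      | OrG \<Rightarrow> \<exists>h. (h, g) \<in> wires C \<and> v h))"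

text \<open>In a well-formed circuit the valuation is unique on the gates.\<close>

definition accepts :: "'g circuit \<Rightarrow> bool list \<Rightarrow> bool" where
  "accepts C w \<longleftrightarrow> (\<exists>v. gate_valuation C w v \<and> v (outgate C))"

text \<open>Uniformity is first-order uniformity: the circuit for inputs of length \<open>m\<close> is obtained from
  an initial segment of the natural numbers with order and arithmetic by a fixed
  first-order query. For constant depth and polynomial size this is DLOGTIME uniformity
  (Barrington, Immerman and Straubing, \<^emph>\<open>On uniformity within NC1\<close>, 1990).\<close>

datatype nform =
    NEq nat nat | NLess nat nat | NPlus nat nat nat | NTimes nat nat nat
  | NNeg nform | NConj nform nform | NEx nat nform

primrec nsat :: "nat \<Rightarrow> (nat \<Rightarrow> nat) \<Rightarrow> nform \<Rightarrow> bool" where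
  "nsat N v (NEq x y) \<longleftrightarrow> v x = v y"
| "nsat N v (NLess x y) \<longleftrightarrow> v x < v y"
| "nsat N v (NPlus x y z) \<longleftrightarrow> v x + v y = v z"
| "nsat N v (NTimes x y z) \<longleftrightarrow> v x * v y = v z"
| "nsat N v (NNeg \<phi>) \<longleftrightarrow> \<not> nsat N v \<phi>"
| "nsat N v (NConj \<phi> \<psi>) \<longleftrightarrow> nsat N v \<phi> \<and> nsat N v \<psi>"
| "nsat N v (NEx x \<phi>) \<longleftrightarrow> (\<exists>a<N. nsat N (v(x := a)) \<phi>)"

text \<open>The segment used for length \<open>m\<close> is \<open>{..<m + 2}\<close>, so that it has two elements even for the
  shortest inputs. Variable \<open>i\<close> denotes the \<open>i\<close>-th component of the tuple.\<close>

definition fo_definable :: "nat \<Rightarrow> (nat \<Rightarrow> nat list set) \<Rightarrow> bool" where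
  "fo_definable k R \<longleftrightarrow> (\<exists>\<phi>. \<forall>m. R m =
     {xs. length xs = k \<and> set xs \<subseteq> {..<m + 2} \<and>
          nsat (m + 2) (\<lambda>i. if i < length xs then xs ! i else 0) \<phi>})"

definition fo_uniform :: "(nat \<Rightarrow> nat list circuit) \<Rightarrow> bool" where
  "fo_uniform C \<longleftrightarrow> (\<exists>k.
     fo_definable k (\<lambda>m. gates (C m)) \<and>
     fo_definable k (\<lambda>m. {g \<in> gates (C m). kind (C m) g = NotG}) \<and>
     fo_definable k (\<lambda>m. {g \<in> gates (C m). kind (C m) g = AndG}) \<and>
     fo_definable k (\<lambda>m. {g \<in> gates (C m). kind (C m) g = OrG}) \<and>
     fo_definable (k + 1) (\<lambda>m. {g @ [i] | g i. g \<in> gates (C m) \<and> kind (C m) g = InputG i}) \<and>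
     fo_definable (k + k) (\<lambda>m. {g @ h | g h. (g, h) \<in> wires (C m)}) \<and>
     fo_definable k (\<lambda>m. {outgate (C m)}))"

text \<open>\<open>in_AC0 enc P Y\<close>: the problem ``given an instance \<open>x \<in> P\<close>, decide whether \<open>x \<in> Y\<close>'' is in
  \<open>AC\<^sup>0\<close>, where \<open>enc x\<close> is the set of words that represent \<open>x\<close>.\<close>

definition in_AC0 :: "('a \<Rightarrow> bool list set) \<Rightarrow> 'a set \<Rightarrow> 'a set \<Rightarrow> bool" where
  "in_AC0 enc P Y \<longleftrightarrow> (\<exists>(C :: nat \<Rightarrow> nat list circuit) d c.
     fo_uniform C \<and>
     (\<forall>m. wf_circuit m (C m) \<and> circuit_depth_le (C m) d \<and>
          card (gates (C m)) \<le> c * (m + 1) ^ c) \<and>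
     (\<forall>x\<in>P. \<forall>w\<in>enc x. accepts (C (length w)) w \<longleftrightarrow> x \<in> Y))"


section \<open>ABoxes as words\<close>

text \<open>An ABox is written as a list of its facts in any order. Each of the four symbols
  0, 1, end of name, end of fact takes two bits; a concept fact consists of two names and a
  role fact of three.\<close>

definition code_name :: "name \<Rightarrow> bool list" where
  "code_name w = concat (map (\<lambda>b. [False, b]) w) @ [True, False]"

fun code_fact :: "fact \<Rightarrow> bool list" where
  "code_fact (CFact A a) = code_name A @ code_name a @ [True, True]"
| "code_fact (RFact r a b) = code_name r @ code_name a @ code_name b @ [True, True]"

definition abox_words :: "abox \<Rightarrow> bool list set" where
  "abox_words A = {concat (map code_fact fs) | fs. set fs = A}"

text \<open>Sanity checks: the tree size satisfies the intended recursion, a word represents at most one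
  ABox, and gate values are unique.\<close>

lemma vertex_tree_size_rec:
  assumes "proof_of U \<eta> p"
  shows "leaf p v \<Longrightarrow> vertex_tree_size p v = 1"
    and "(S, v) \<in> infs p \<Longrightarrow> vertex_tree_size p v = 1 + (\<Sum>s\<in>S. vertex_tree_size p s)"
proof -
  have sub: "step_rel p \<subseteq> verts p \<times> verts p"
  proof -
    have "\<forall>(S, d) \<in> infs p. S \<subseteq> verts p \<and> d \<in> verts p"
      using assms by (auto simp only: proof_of_def derivation_structure_def)
    then show ?thesis by (auto simp: step_rel_def)
  qed
  have "finite (step_rel p)"
    using sub assms finite_subset[of "step_rel p" "verts p \<times> verts p"]
    by (simp add: proof_of_def)
  then have wf: "wf (step_rel p)"
    using assms by (simp add: proof_of_def finite_acyclic_wf)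
  have rec: "vertex_tree_size p v = 1 + (\<Sum>s | (s, v) \<in> step_rel p. vertex_tree_size p s)" for v
    unfolding vertex_tree_size_def
    by (rule trans[OF wfrec[OF wf]]) (simp add: cut_apply)
  show "vertex_tree_size p v = 1" if "leaf p v"
  proof -
    have "{s. (s, v) \<in> step_rel p} = {}"
      using that by (auto simp: leaf_def step_rel_def)
    then show ?thesis by (simp add: rec[of v])
  qed
  show "vertex_tree_size p v = 1 + (\<Sum>s\<in>S. vertex_tree_size p s)" if "(S, v) \<in> infs p"
  proof -
    have "\<forall>d S S'. (S, d) \<in> infs p \<longrightarrow> (S', d) \<in> infs p \<longrightarrow> S = S'"
      using assms unfolding proof_of_def by (elim conjE)
    then have "{s. (s, v) \<in> step_rel p} = S"
      using that unfolding step_rel_def by blast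
    then show ?thesis by (simp add: rec[of v])
  qed
qed

lemma code_name_Nil: "code_name [] = [True, False]"
  by (simp add: code_name_def)

lemma code_name_Cons: "code_name (b # w) = False # b # code_name w"
  by (simp add: code_name_def)

lemma code_name_append_inj: "code_name v @ x = code_name w @ y \<Longrightarrow> v = w \<and> x = y"
proof (induction v arbitrary: w)
  case Nil
  then show ?case by (cases w) (simp_all add: code_name_Nil code_name_Cons)
next
  case (Cons b v)
  show ?case
  proof (cases w)
    case Nil
    then show ?thesis using Cons.prems by (simp add: code_name_Nil code_name_Cons)
  next
    case w: (Cons c w')
    then have "b = c" "code_name v @ x = code_name w' @ y"
      using Cons.prems by (simp_all add: code_name_Cons)
    then show ?thesis using Cons.IH[of w'] w by blast
  qed
qed

lemma code_name_append_iff: "code_name v @ x = code_name w @ y \<longleftrightarrow> v = w \<and> x = y"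
  using code_name_append_inj by blast

lemma code_name_neq: "code_name w @ x \<noteq> True # True # y"
  by (cases w) (auto simp: code_name_def)

lemma code_fact_append_inj: "code_fact f @ x = code_fact g @ y \<Longrightarrow> f = g \<and> x = y"
  by (cases f; cases g)
    (simp_all add: code_name_append_iff code_name_neq code_name_neq[THEN not_sym])

lemma abox_words_disjoint:
  assumes "w \<in> abox_words A" "w \<in> abox_words B"
  shows "A = B"
proof -
  have ne: "code_fact f \<noteq> []" for f
    by (cases f) auto
  have "fs = gs" if "concat (map code_fact fs) = concat (map code_fact gs)" for fs gs
    using that
  proof (induction fs arbitrary: gs)
    case Nil
    then show ?case using ne by (cases gs) auto
  next
    case (Cons f fs)
    then obtain g gs' where gs: "gs = g # gs'" using ne by (cases gs) auto
    then show ?case using Cons.prems Cons.IH[of gs']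
      code_fact_append_inj[of f "concat (map code_fact fs)" g "concat (map code_fact gs')"] by simp
  qed
  then show ?thesis
    using assms unfolding abox_words_def by blast
qed

lemma gate_valuation_unique:
  assumes "wf_circuit m C" "gate_valuation C w v" "gate_valuation C w v'" "g \<in> gates C"
  shows "v g = v' g"
proof -
  have "finite (wires C)" "acyclic (wires C)" and sub: "wires C \<subseteq> gates C \<times> gates C"
    using assms(1) finite_subset[of "wires C" "gates C \<times> gates C"] by (auto simp: wf_circuit_def)
  then have "wf (wires C)" using finite_acyclic_wf by blast
  then show ?thesis using assms(4)
  proof (induction g rule: wf_induct_rule)
    case (less g)
    then have "\<And>h. (h, g) \<in> wires C \<Longrightarrow> v h = v' h" using sub by blast
    then show ?case
      using assms(2,3) less.prems by (auto simp: gate_valuation_def split: gate.splits)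
  qed
qed

end

theory Submission
  imports Defs
begin

text \<open>Whether an ABox has a proof of measure at most \<open>n\<close> is monotone in the ABox, invariant under
  injective renamings of names that fix the names of \<open>T\<close> and \<open>q\<close>, and local: some subset of at most
  \<open>K\<close> facts already has such a proof, with \<open>K\<close> depending only on \<open>T\<close>, \<open>q\<close> and \<open>n\<close>. For the size and
  the tree size locality holds because the leaves of a proof are vertices; for the domain size, names
  that do not occur in \<open>T\<close> and \<open>q\<close> are first identified when they label the same facts over the
  individuals of the proof. Such a property says that the ABox contains one of finitely many patterns
  of at most \<open>K\<close> facts, where a pattern fixes the kinds of the facts and the equalities among their
  names and the names of \<open>T\<close> and \<open>q\<close>. Names of unbounded length are compared symbol by symbol, so
  this is first-order over words with arithmetic on positions, hence in uniform \<open>AC\<^sup>0\<close>.\<close>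

section \<open>First-order formulas over words as circuits\<close>

text \<open>The circuits compute nothing about proofs: for fixed \<open>T\<close>, \<open>q\<close>
  and \<open>n\<close>, the patterns that admit a small enough proof form some finite set, built
  into one formula in advance. With a formula as the target, depth, size and uniformity are settled
  once, by compilation: a gate is a subformula together with values for its variables, so the depth
  is bounded by the size of the formula and the number of gates is polynomial.

  Names can be merged because renaming symbols preserves entailment, and inferences survive it as
  long as the rules of \<open>T\<close> and the query stay fixed. Individual names must be renamed
  injectively, since (E) tests terms for equality; hence the three separate maps for concept, role
  and individual names. Concept names are merged only when they hold of the same individuals of the
  proof, and likewise role names for pairs, so that every renamed leaf is again a fact of the
  ABox.\<close>

datatype wform =
  WNum nform | WBit nat | WNeg wform | WConj wform wform | WEx nat wform

primrec wsat :: "bool list \<Rightarrow> (nat \<Rightarrow> nat) \<Rightarrow> wform \<Rightarrow> bool" where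
  "wsat w v (WNum \<theta>) \<longleftrightarrow> nsat (length w + 2) v \<theta>"
| "wsat w v (WBit x) \<longleftrightarrow> v x < length w \<and> w ! v x"
| "wsat w v (WNeg \<phi>) \<longleftrightarrow> \<not> wsat w v \<phi>"
| "wsat w v (WConj \<phi> \<psi>) \<longleftrightarrow> wsat w v \<phi> \<and> wsat w v \<psi>"
| "wsat w v (WEx x \<phi>) \<longleftrightarrow> (\<exists>a<length w + 2. wsat w (v(x := a)) \<phi>)"

text \<open>The default 0 agrees with the valuation of tuples used in
  \<open>fo_definable\<close>.\<close>

definition env :: "nat list \<Rightarrow> nat \<Rightarrow> nat" where
  "env xs i = (if i < length xs then xs ! i else 0)"

lemma env_update: "x < length xs \<Longrightarrow> env (xs[x := c]) = (env xs)(x := c)"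
  by (auto simp: env_def fun_eq_iff)

lemma env_drop: "env (drop L xs) i = env xs (L + i)"
  by (auto simp: env_def)

lemma env_replicate_zero [simp]: "env (replicate k 0) = (\<lambda>_. 0)"
  by (auto simp: env_def fun_eq_iff)

lemma env_eq_iff: "length xs = length ys \<Longrightarrow> xs = ys \<longleftrightarrow> (\<forall>i<length ys. env xs i = env ys i)"
  by (auto simp: env_def list_eq_iff_nth_eq)

text \<open>Definability is stated for predicates on valuations, so that it can be proved by closure
  rules without writing down formulas.\<close>

definition ndef :: "(nat \<Rightarrow> (nat \<Rightarrow> nat) \<Rightarrow> bool) \<Rightarrow> bool" where
  "ndef P \<longleftrightarrow> (\<exists>\<phi>. \<forall>m v. nsat (m + 2) v \<phi> \<longleftrightarrow> P m v)"

lemma fo_definableI: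
  assumes "ndef P"
    and "\<And>m. R m = {xs. length xs = k \<and> set xs \<subseteq> {..<m + 2} \<and> P m (env xs)}"
  shows "fo_definable k R"
proof -
  obtain \<phi> where "\<And>m v. nsat (m + 2) v \<phi> \<longleftrightarrow> P m v"
    using assms(1) unfolding ndef_def by blast
  moreover have "(\<lambda>i. if i < length xs then xs ! i else 0) = env xs" for xs :: "nat list"
    by (auto simp: env_def fun_eq_iff)
  ultimately show ?thesis
    unfolding fo_definable_def assms(2) by (intro exI[of _ \<phi>]) simp
qed

lemma ndef_neg: assumes "ndef P" shows "ndef (\<lambda>m v. \<not> P m v)"
proof -
  obtain \<phi> where "\<And>m v. nsat (m + 2) v \<phi> \<longleftrightarrow> P m v"
    using assms unfolding ndef_def by blast
  then show ?thesis unfolding ndef_def by (intro exI[of _ "NNeg \<phi>"]) simp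
qed

lemma ndef_conj: assumes "ndef P" "ndef Q" shows "ndef (\<lambda>m v. P m v \<and> Q m v)"
proof -
  obtain \<phi> \<psi> where "\<And>m v. nsat (m + 2) v \<phi> \<longleftrightarrow> P m v" "\<And>m v. nsat (m + 2) v \<psi> \<longleftrightarrow> Q m v"
    using assms unfolding ndef_def by blast
  then show ?thesis unfolding ndef_def by (intro exI[of _ "NConj \<phi> \<psi>"]) simp
qed

lemma ndef_disj: "ndef P \<Longrightarrow> ndef Q \<Longrightarrow> ndef (\<lambda>m v. P m v \<or> Q m v)"
  using ndef_neg[OF ndef_conj[OF ndef_neg[of P] ndef_neg[of Q]]] by simp

lemma ndef_eq: "ndef (\<lambda>m v. v i = v j)"
  unfolding ndef_def by (intro exI[of _ "NEq i j"]) simp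

lemma ndef_True: "ndef (\<lambda>m v. True)"
  using ndef_eq[of 0 0] by simp

lemma ndef_const: "ndef (\<lambda>m v. b)"
  using ndef_True ndef_neg[OF ndef_True] by (cases b) simp_all

lemma ndef_zero: "ndef (\<lambda>m v. v i = 0)"
  unfolding ndef_def by (intro exI[of _ "NPlus i i i"]) simp

text \<open>The syntax has no constants; 0 and 1 are the idempotents of multiplication, and 0 is the
  one that also satisfies \<open>i + i = i\<close>.\<close>

lemma ndef_one: "ndef (\<lambda>m v. v i = 1)"
  unfolding ndef_def by (intro exI[of _ "NConj (NTimes i i i) (NNeg (NPlus i i i))"]) auto

lemma ndef_less_length: "ndef (\<lambda>m v. v i < m)"
proof -
  \<comment> \<open>The segment ends at \<open>m + 1\<close>, so a number lies below
    \<open>m\<close> iff two further elements lie above it.\<close>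
  have "nsat (m + 2) v (NEx (Suc i) (NEx (Suc (Suc i))
      (NConj (NLess i (Suc i)) (NLess (Suc i) (Suc (Suc i)))))) \<longleftrightarrow> v i < m" for m v
  proof -
    have "(\<exists>a<m + 2. \<exists>b<m + 2. v i < a \<and> a < b) \<longleftrightarrow> v i < m" by presburger
    then show ?thesis by simp
  qed
  then show ?thesis unfolding ndef_def by blast
qed

lemma ndef_ball: "finite I \<Longrightarrow> (\<And>i. i \<in> I \<Longrightarrow> ndef (P i)) \<Longrightarrow> ndef (\<lambda>m v. \<forall>i\<in>I. P i m v)"
  by (induction I rule: finite_induct) (simp_all add: ndef_True ndef_conj)

lemma ndef_bex: "finite I \<Longrightarrow> (\<And>i. i \<in> I \<Longrightarrow> ndef (P i)) \<Longrightarrow> ndef (\<lambda>m v. \<exists>i\<in>I. P i m v)"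
  using ndef_neg[OF ndef_ball[of I "\<lambda>i m v. \<not> P i m v"]] ndef_neg by simp

text \<open>In a gate tuple the assignment stands behind a block that codes the subformula, so
  variable \<open>i\<close> of a numerical formula has to be read at component
  \<open>l + i\<close>.\<close>

primrec nshift :: "nat \<Rightarrow> nform \<Rightarrow> nform" where
  "nshift l (NEq x y) = NEq (l + x) (l + y)"
| "nshift l (NLess x y) = NLess (l + x) (l + y)"
| "nshift l (NPlus x y z) = NPlus (l + x) (l + y) (l + z)"
| "nshift l (NTimes x y z) = NTimes (l + x) (l + y) (l + z)"
| "nshift l (NNeg \<phi>) = NNeg (nshift l \<phi>)"
| "nshift l (NConj \<phi> \<psi>) = NConj (nshift l \<phi>) (nshift l \<psi>)"
| "nshift l (NEx x \<phi>) = NEx (l + x) (nshift l \<phi>)"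

lemma nsat_nshift: "nsat N v (nshift l \<phi>) \<longleftrightarrow> nsat N (\<lambda>i. v (l + i)) \<phi>"
proof (induction \<phi> arbitrary: v)
  case (NEx x \<phi>)
  have "(\<lambda>i. (v(l + x := a)) (l + i)) = (\<lambda>i. v (l + i))(x := a)" for a
    by auto
  then show ?case by (simp add: NEx.IH)
qed auto

lemma ndef_nsat_shift: "ndef (\<lambda>m v. nsat (m + 2) (\<lambda>i. v (l + i)) \<theta>)"
  unfolding ndef_def by (intro exI[of _ "nshift l \<theta>"]) (simp only: nsat_nshift simp_thms)

section \<open>Subformulas and the kinds of their gates\<close>

primrec subforms :: "wform \<Rightarrow> wform set" where
  "subforms (WNum \<theta>) = {WNum \<theta>}"
| "subforms (WBit x) = {WBit x}"
| "subforms (WNeg \<phi>) = insert (WNeg \<phi>) (subforms \<phi>)"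
| "subforms (WConj \<phi> \<psi>) = insert (WConj \<phi> \<psi>) (subforms \<phi> \<union> subforms \<psi>)"
| "subforms (WEx x \<phi>) = insert (WEx x \<phi>) (subforms \<phi>)"

fun children :: "wform \<Rightarrow> wform set" where
  "children (WNeg \<phi>) = {\<phi>}"
| "children (WConj \<phi> \<psi>) = {\<phi>, \<psi>}"
| "children (WEx x \<phi>) = {\<phi>}"
| "children _ = {}"

lemma finite_subforms [simp]: "finite (subforms \<phi>)"
  by (induction \<phi>) auto

lemma self_subforms [simp]: "\<phi> \<in> subforms \<phi>"
  by (cases \<phi>) auto

lemma children_subforms: "\<psi> \<in> subforms \<phi> \<Longrightarrow> children \<psi> \<subseteq> subforms \<phi>"
  by (induction \<phi>) auto

lemma size_children: "\<chi> \<in> children \<psi> \<Longrightarrow> size \<chi> < size \<psi>"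
  by (cases \<psi>) auto

lemma size_subforms: "\<psi> \<in> subforms \<phi> \<Longrightarrow> size \<psi> \<le> size \<phi>"
  by (induction \<phi>) auto

primrec wvars :: "wform \<Rightarrow> nat set" where
  "wvars (WNum \<theta>) = {}"
| "wvars (WBit x) = {x}"
| "wvars (WNeg \<phi>) = wvars \<phi>"
| "wvars (WConj \<phi> \<psi>) = wvars \<phi> \<union> wvars \<psi>"
| "wvars (WEx x \<phi>) = insert x (wvars \<phi>)"

lemma finite_wvars [simp]: "finite (wvars \<phi>)"
  by (induction \<phi>) auto

lemma wvars_subforms: "\<psi> \<in> subforms \<phi> \<Longrightarrow> wvars \<psi> \<subseteq> wvars \<phi>"
  by (induction \<phi>) auto

text \<open>Numerical atoms depend only on the length of the input and become constants: an
  \<open>AndG\<close> without wires is true, an \<open>OrG\<close> without wires is false. The two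
  positions behind the word carry no input bit and also become the constant false.\<close>

fun form_kind :: "nat \<Rightarrow> (nat \<Rightarrow> nat) \<Rightarrow> wform \<Rightarrow> gate" where
  "form_kind m v (WNum \<theta>) = (if nsat (m + 2) v \<theta> then AndG else OrG)"
| "form_kind m v (WBit x) = (if v x < m then InputG (v x) else OrG)"
| "form_kind m v (WNeg \<phi>) = NotG"
| "form_kind m v (WConj \<phi> \<psi>) = AndG"
| "form_kind m v (WEx x \<phi>) = OrG"

fun quant_vars :: "wform \<Rightarrow> nat set" where
  "quant_vars (WEx x \<phi>) = {x}"
| "quant_vars _ = {}"

text \<open>Input gates form a family indexed by the bit they read; they are treated separately,
  with one more component for the index.\<close>

lemma ndef_form_kind:
  assumes "\<forall>i. K \<noteq> InputG i"
  shows "ndef (\<lambda>m v. form_kind m (\<lambda>i. v (l + i)) \<psi> = K)"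
proof (cases \<psi>)
  case (WNum \<theta>)
  have "(\<lambda>m v. form_kind m (\<lambda>i. v (l + i)) \<psi> = K) =
      (\<lambda>m v. nsat (m + 2) (\<lambda>i. v (l + i)) \<theta> \<and> K = AndG \<or>
        \<not> nsat (m + 2) (\<lambda>i. v (l + i)) \<theta> \<and> K = OrG)"
    by (auto simp: WNum fun_eq_iff simp del: add_2_eq_Suc')
  then show ?thesis
    by (simp only:) (intro ndef_disj ndef_conj ndef_neg ndef_nsat_shift ndef_const)
next
  case (WBit x)
  have "(\<lambda>m v. form_kind m (\<lambda>i. v (l + i)) \<psi> = K) = (\<lambda>m v. \<not> v (l + x) < m \<and> K = OrG)"
    using assms by (auto simp: WBit fun_eq_iff)
  then show ?thesis
    by (simp only:) (intro ndef_conj ndef_neg ndef_less_length ndef_const)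
qed (simp_all add: ndef_const)

text \<open>A gate is a subformula, given by the one-hot code of its index, followed by an assignment.
  Codes in \<open>{0, 1}\<close> are available even in the smallest segment \<open>{..<2}\<close>.\<close>

locale compiled =
  fixes \<phi> :: wform and us :: "wform list" and V :: nat
  assumes us: "set us = subforms \<phi>" "distinct us"
    and V: "wvars \<phi> \<subseteq> {..<V}"
begin

abbreviation L :: nat where "L \<equiv> length us"

definition code :: "wform \<Rightarrow> nat list" where
  "code \<psi> = map (\<lambda>\<chi>. if \<chi> = \<psi> then 1 else 0) us"

lemma length_code [simp]: "length (code \<psi>) = L"
  by (simp add: code_def)

lemma set_code: "set (code \<psi>) \<subseteq> {..<m + 2}"
  by (auto simp: code_def)

lemma inj_code: "inj_on code (subforms \<phi>)"
proof (rule inj_onI)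
  fix \<psi> \<chi> assume "\<psi> \<in> subforms \<phi>" and "code \<psi> = code \<chi>"
  then show "\<psi> = \<chi>"
    unfolding code_def using us(1) by (auto split: if_splits)
qed

definition decode :: "nat list \<Rightarrow> wform" where
  "decode = the_inv_into (subforms \<phi>) code"

lemma decode_code [simp]: "\<psi> \<in> subforms \<phi> \<Longrightarrow> decode (code \<psi>) = \<psi>"
  unfolding decode_def by (rule the_inv_into_f_f[OF inj_code])

lemma code_eq_iff: "\<psi> \<in> subforms \<phi> \<Longrightarrow> \<chi> \<in> subforms \<phi> \<Longrightarrow> code \<psi> = code \<chi> \<longleftrightarrow> \<psi> = \<chi>"
  using inj_code by (auto dest: inj_onD)

definition assigns :: "nat \<Rightarrow> nat list set" where
  "assigns m = {a. set a \<subseteq> {..<m + 2} \<and> length a = V}"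

text \<open>\<open>a\<close> belongs to the child and \<open>b\<close> to its parent. A quantifier
  gate thus receives one wire for each value of its variable, any other gate one wire per child with
  its own assignment.\<close>

definition wired :: "nat list \<Rightarrow> wform \<Rightarrow> nat list \<Rightarrow> wform \<Rightarrow> bool" where
  "wired a \<psi> b \<chi> \<longleftrightarrow> \<psi> \<in> children \<chi> \<and> (\<forall>i\<in>{..<V} - quant_vars \<chi>. env a i = env b i)"

text \<open>The zero block of the output gate stands for the valuation \<open>\<lambda>_. 0\<close>
  under which the formula is finally read.\<close>

definition C :: "nat \<Rightarrow> nat list circuit" where
  "C m = \<lparr>gates = {code \<psi> @ a | \<psi> a. \<psi> \<in> subforms \<phi> \<and> a \<in> assigns m},
     kind = (\<lambda>g. form_kind m (env (drop L g)) (decode (take L g))),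
     wires = {(code \<psi> @ a, code \<chi> @ b) | \<psi> a \<chi> b. \<psi> \<in> subforms \<phi> \<and> \<chi> \<in> subforms \<phi> \<and>
       a \<in> assigns m \<and> b \<in> assigns m \<and> wired a \<psi> b \<chi>},
     outgate = code \<phi> @ replicate V 0\<rparr>"

lemma gate_iff [simp]:
  "\<psi> \<in> subforms \<phi> \<Longrightarrow> code \<psi> @ a \<in> gates (C m) \<longleftrightarrow> a \<in> assigns m"
  by (auto simp: C_def)

lemma gateE:
  assumes "g \<in> gates (C m)"
  obtains \<psi> a where "g = code \<psi> @ a" "\<psi> \<in> subforms \<phi>" "a \<in> assigns m"
  using assms by (auto simp: C_def)

lemma kind_C [simp]:
  "\<psi> \<in> subforms \<phi> \<Longrightarrow> kind (C m) (code \<psi> @ a) = form_kind m (env a) \<psi>"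
  by (simp add: C_def)

lemma wire_iff:
  assumes "\<chi> \<in> subforms \<phi>" "b \<in> assigns m"
  shows "(h, code \<chi> @ b) \<in> wires (C m) \<longleftrightarrow>
    (\<exists>\<psi>\<in>children \<chi>. \<exists>a\<in>assigns m. h = code \<psi> @ a \<and> wired a \<psi> b \<chi>)"
proof
  assume "(h, code \<chi> @ b) \<in> wires (C m)"
  then show "\<exists>\<psi>\<in>children \<chi>. \<exists>a\<in>assigns m. h = code \<psi> @ a \<and> wired a \<psi> b \<chi>"
    using assms code_eq_iff by (fastforce simp: C_def wired_def)
next
  assume "\<exists>\<psi>\<in>children \<chi>. \<exists>a\<in>assigns m. h = code \<psi> @ a \<and> wired a \<psi> b \<chi>"
  then show "(h, code \<chi> @ b) \<in> wires (C m)"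
    using assms children_subforms[OF assms(1)] by (fastforce simp: C_def)
qed

lemma wired_no_quant:
  assumes "a \<in> assigns m" "b \<in> assigns m" "quant_vars \<chi> = {}"
  shows "wired a \<psi> b \<chi> \<longleftrightarrow> \<psi> \<in> children \<chi> \<and> a = b"
  using assms env_eq_iff[of a b] by (auto simp: wired_def assigns_def)

lemma wired_WEx:
  assumes "a \<in> assigns m" "b \<in> assigns m" "x < V"
  shows "wired a \<psi> b (WEx x \<chi>) \<longleftrightarrow> \<psi> = \<chi> \<and> (\<exists>c<m + 2. a = b[x := c])"
proof -
  have "(\<forall>i\<in>{..<V} - {x}. env a i = env b i) \<longleftrightarrow> (\<exists>c<m + 2. a = b[x := c])" (is "?l \<longleftrightarrow> ?r")
  proof
    assume ?l
    then have 1: "a = b[x := a ! x]"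
      using assms by (intro nth_equalityI) (auto simp: assigns_def env_def nth_list_update)
    have "a ! x \<in> set a" using assms by (simp add: assigns_def)
    moreover have "set a \<subseteq> {..<m + 2}" using assms by (simp add: assigns_def)
    ultimately have "a ! x < m + 2" by blast
    with 1 show ?r by (intro exI[of _ "a ! x"] conjI)
  next
    assume ?r
    then obtain c where "a = b[x := c]" by blast
    moreover have "x < length b" using assms by (simp add: assigns_def)
    ultimately show ?l by (simp add: env_update)
  qed
  then show ?thesis by (simp add: wired_def)
qed

lemma quant_var_bound: "WEx x \<psi> \<in> subforms \<phi> \<Longrightarrow> x < V"
  using wvars_subforms[of "WEx x \<psi>" \<phi>] V by auto

lemma bit_var_bound: "WBit x \<in> subforms \<phi> \<Longrightarrow> x < V"
  using wvars_subforms[of "WBit x" \<phi>] V by auto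

text \<open>Each gate gets the truth value of its subformula under its assignment. Checking the
  local gate equations is enough, since a well-formed circuit has only one valuation.\<close>

lemma gate_valuation_C:
  "gate_valuation (C (length w)) w (\<lambda>g. wsat w (env (drop L g)) (decode (take L g)))"
    (is "gate_valuation _ _ ?v")
  unfolding gate_valuation_def
proof
  fix g assume "g \<in> gates (C (length w))"
  then obtain \<psi> a where g: "g = code \<psi> @ a" and \<psi>: "\<psi> \<in> subforms \<phi>"
    and a: "a \<in> assigns (length w)"
    by (rule gateE)
  have v: "?v (code \<chi> @ b) = wsat w (env b) \<chi>" if "\<chi> \<in> subforms \<phi>" for \<chi> b
    using that by simp
  note ch = children_subforms[OF \<psi>]
  have w: "(\<exists>h. (h, g) \<in> wires (C (length w)) \<and> ?v h) \<longleftrightarrow>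
      (\<exists>\<chi>\<in>children \<psi>. \<exists>b\<in>assigns (length w). wired b \<chi> a \<psi> \<and> wsat w (env b) \<chi>)"
    "(\<forall>h. (h, g) \<in> wires (C (length w)) \<longrightarrow> ?v h) \<longleftrightarrow>
      (\<forall>\<chi>\<in>children \<psi>. \<forall>b\<in>assigns (length w). wired b \<chi> a \<psi> \<longrightarrow> wsat w (env b) \<chi>)"
    unfolding g wire_iff[OF \<psi> a] using ch v by fastforce+
  have k: "kind (C (length w)) g = form_kind (length w) (env a) \<psi>" using \<psi> by (simp add: g)
  have "?v g = wsat w (env a) \<psi>" using v[OF \<psi>] g by simp
  also have "\<dots> = (case kind (C (length w)) g of
      InputG i \<Rightarrow> w ! i
    | NotG \<Rightarrow> \<not> (\<exists>h. (h, g) \<in> wires (C (length w)) \<and> ?v h)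
    | AndG \<Rightarrow> \<forall>h. (h, g) \<in> wires (C (length w)) \<longrightarrow> ?v h
    | OrG \<Rightarrow> \<exists>h. (h, g) \<in> wires (C (length w)) \<and> ?v h)"
  proof (cases \<psi>)
    case (WNum \<theta>)
    then show ?thesis by (cases "nsat (length w + 2) (env a) \<theta>") (simp_all add: k w)
  next
    case (WBit x)
    then show ?thesis by (cases "env a x < length w") (simp_all add: k w)
  next
    case (WNeg \<chi>)
    then have "\<And>b. b \<in> assigns (length w) \<Longrightarrow> wired b \<chi> a \<psi> \<longleftrightarrow> b = a"
      using wired_no_quant[OF _ a, of _ \<psi> \<chi>] by simp
    then show ?thesis using WNeg a by (auto simp: k w)
  next
    case (WConj \<chi>1 \<chi>2)
    then have "\<And>b \<chi>. b \<in> assigns (length w) \<Longrightarrow>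
        wired b \<chi> a \<psi> \<longleftrightarrow> \<chi> \<in> children \<psi> \<and> b = a"
      using wired_no_quant[OF _ a, of _ \<psi>] by simp
    then show ?thesis using WConj a by (auto simp: k w)
  next
    case (WEx x \<chi>)
    have x: "x < V" using quant_var_bound \<psi> WEx by simp
    have "(\<exists>b\<in>assigns (length w). wired b \<chi> a \<psi> \<and> wsat w (env b) \<chi>) \<longleftrightarrow>
        (\<exists>b\<in>assigns (length w). (\<exists>c<length w + 2. b = a[x := c]) \<and> wsat w (env b) \<chi>)"
      using wired_WEx[OF _ a x] WEx by blast
    also have "\<dots> \<longleftrightarrow> (\<exists>c<length w + 2. wsat w (env (a[x := c])) \<chi>)"
    proof -
      have "a[x := c] \<in> assigns (length w)" if "c < length w + 2" for c
        using a that set_update_subset_insert[of a x c] by (auto simp: assigns_def)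
      then show ?thesis by blast
    qed
    also have "\<dots> \<longleftrightarrow> wsat w (env a) \<psi>"
      using a x WEx by (simp add: env_update assigns_def)
    finally have *: "(\<exists>b\<in>assigns (length w). wired b \<chi> a \<psi> \<and> wsat w (env b) \<chi>) \<longleftrightarrow>
      wsat w (env a) \<psi>" .
    then show ?thesis using WEx by (simp add: k w)
  qed
  finally show "?v g = (case kind (C (length w)) g of
      InputG i \<Rightarrow> w ! i
    | NotG \<Rightarrow> \<not> (\<exists>h. (h, g) \<in> wires (C (length w)) \<and> ?v h)
    | AndG \<Rightarrow> \<forall>h. (h, g) \<in> wires (C (length w)) \<longrightarrow> ?v h
    | OrG \<Rightarrow> \<exists>h. (h, g) \<in> wires (C (length w)) \<and> ?v h)" .
qed

lemma finite_assigns: "finite (assigns m)"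
  unfolding assigns_def by (rule finite_lists_length_eq) simp

lemma gates_eq: "gates (C m) = (\<lambda>(\<psi>, a). code \<psi> @ a) ` (subforms \<phi> \<times> assigns m)"
  by (auto simp: C_def)

lemma outgate_in: "outgate (C m) \<in> gates (C m)"
  by (auto simp: C_def assigns_def)

lemma wire_size:
  assumes "(g, h) \<in> wires (C m)"
  shows "size (decode (take L g)) < size (decode (take L h))"
  using assms size_children by (auto simp: C_def wired_def)

text \<open>Each wire leads to a strictly larger formula. This excludes cycles and bounds the depth
  independently of \<open>m\<close>.\<close>

lemma wires_relpow_size:
  "(g, h) \<in> wires (C m) ^^ k \<Longrightarrow> k + size (decode (take L g)) \<le> size (decode (take L h))"
proof (induction k arbitrary: h)
  case (Suc k)
  then obtain h' where "(g, h') \<in> wires (C m) ^^ k" "(h', h) \<in> wires (C m)" by auto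
  then show ?case using Suc.IH wire_size by fastforce
qed simp

lemma wires_gates: "wires (C m) \<subseteq> gates (C m) \<times> gates (C m)"
  by (auto simp: C_def)

lemma circuit_depth_C: "circuit_depth_le (C m) (size \<phi>)"
  unfolding circuit_depth_le_def
proof -
  have False if gh: "(g, h) \<in> wires (C m) ^^ Suc (size \<phi>)" for g h
  proof -
    have "h \<in> gates (C m)" using gh wires_gates by auto
    then obtain \<psi> a where "h = code \<psi> @ a" "\<psi> \<in> subforms \<phi>" by (rule gateE)
    then have "size (decode (take L h)) \<le> size \<phi>" using size_subforms by simp
    then show False using wires_relpow_size[OF gh] by simp
  qed
  then show "wires (C m) ^^ Suc (size \<phi>) = {}" by auto
qed

lemma wf_circuit_C: "wf_circuit m (C m)"
  unfolding wf_circuit_def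
proof (intro conjI ballI)
  show "finite (gates (C m))" by (simp add: gates_eq finite_assigns)
  show "wires (C m) \<subseteq> gates (C m) \<times> gates (C m)" by (rule wires_gates)
  show "outgate (C m) \<in> gates (C m)" by (rule outgate_in)
  show "acyclic (wires (C m))"
    unfolding acyclic_def
  proof (intro allI notI)
    fix g assume "(g, g) \<in> (wires (C m))\<^sup>+"
    then obtain k where "k > 0" "(g, g) \<in> wires (C m) ^^ k"
      by (auto simp: trancl_power)
    then show False using wires_relpow_size by fastforce
  qed
next
  fix g assume "g \<in> gates (C m)"
  then obtain \<psi> a where g: "g = code \<psi> @ a" and \<psi>: "\<psi> \<in> subforms \<phi>" and a: "a \<in> assigns m"
    by (rule gateE)
  show "case kind (C m) g of InputG i \<Rightarrow> i < m \<and> (\<nexists>h. (h, g) \<in> wires (C m))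
      | NotG \<Rightarrow> \<exists>!h. (h, g) \<in> wires (C m) | _ \<Rightarrow> True"
  proof (cases \<psi>)
    case (WNeg \<chi>)
    then have "wired b \<chi> a \<psi> \<longleftrightarrow> b = a" if "b \<in> assigns m" for b
      using wired_no_quant[OF that a, of \<psi> \<chi>] by simp
    then have "(h, g) \<in> wires (C m) \<longleftrightarrow> h = code \<chi> @ a" for h
      unfolding g wire_iff[OF \<psi> a] using a WNeg by auto
    then show ?thesis using \<psi> WNeg by (simp add: g)
  next
    case (WBit x)
    then have "(h, g) \<notin> wires (C m)" for h
      unfolding g wire_iff[OF \<psi> a] by simp
    then show ?thesis using \<psi> WBit by (simp add: g)
  qed (use \<psi> in \<open>auto simp: g\<close>)
qed

lemma card_gates: "card (gates (C m)) \<le> card (subforms \<phi>) * (m + 2) ^ V"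
proof -
  have "card (gates (C m)) \<le> card (subforms \<phi> \<times> assigns m)"
    unfolding gates_eq by (rule card_image_le) (simp add: finite_assigns)
  then show ?thesis
    by (simp add: card_cartesian_product assigns_def card_lists_length_eq)
qed

lemma accepts_C: "accepts (C (length w)) w \<longleftrightarrow> wsat w (\<lambda>_. 0) \<phi>"
proof -
  let ?v = "\<lambda>g. wsat w (env (drop L g)) (decode (take L g))"
  have "accepts (C (length w)) w \<longleftrightarrow> ?v (outgate (C (length w)))"
    unfolding accepts_def
    using gate_valuation_C gate_valuation_unique[OF wf_circuit_C _ _ outgate_in] by blast
  then show ?thesis by (simp add: C_def)
qed

section \<open>First-order uniformity of the compiled circuits\<close>

definition code_at :: "nat \<Rightarrow> wform \<Rightarrow> (nat \<Rightarrow> nat) \<Rightarrow> bool" where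
  "code_at j \<psi> v \<longleftrightarrow> (\<forall>i\<in>{..<L}. v (j + i) = code \<psi> ! i)"

lemma ndef_code_at: "ndef (\<lambda>m. code_at j \<psi>)"
  unfolding code_at_def
proof (intro ndef_ball)
  fix i assume i: "i \<in> {..<L}"
  show "ndef (\<lambda>m v. v (j + i) = code \<psi> ! i)"
    using ndef_zero[of "j + i"] ndef_one[of "j + i"] i by (auto simp: code_def)
qed simp

lemma code_at_iff: "j + L \<le> length xs \<Longrightarrow> code_at j \<psi> (env xs) \<longleftrightarrow> take L (drop j xs) = code \<psi>"
  by (auto simp: code_at_def env_def list_eq_iff_nth_eq)

lemma gate_tupleE:
  assumes "length g = L + V" "set g \<subseteq> {..<m + 2}" "take L g = code \<psi>"
  obtains a where "g = code \<psi> @ a" "a \<in> assigns m"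
proof
  show "g = code \<psi> @ drop L g" using assms(3) append_take_drop_id[of L g] by simp
  show "drop L g \<in> assigns m" using assms(1,2) set_drop_subset[of L g] by (auto simp: assigns_def)
qed

lemma gate_tuple_props:
  assumes "a \<in> assigns m"
  shows "length (code \<psi> @ a) = L + V" "set (code \<psi> @ a) \<subseteq> {..<m + 2}"
  using assms set_code[of \<psi> m] by (auto simp: assigns_def)

text \<open>The predicate \<open>X\<close> is left open so that the set of all gates and the set of
  gates of one kind are both instances.\<close>

lemma kind_set_eq:
  "{g \<in> gates (C m). X (kind (C m) g)} = {xs. length xs = L + V \<and> set xs \<subseteq> {..<m + 2} \<and>
     (\<exists>\<psi>\<in>subforms \<phi>. code_at 0 \<psi> (env xs) \<and> X (form_kind m (\<lambda>i. env xs (L + i)) \<psi>))}"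
proof (intro set_eqI iffI; clarify)
  fix g assume "g \<in> gates (C m)" and X: "X (kind (C m) g)"
  then obtain \<psi> a where g: "g = code \<psi> @ a" and \<psi>: "\<psi> \<in> subforms \<phi>" and a: "a \<in> assigns m"
    by (elim gateE)
  have "(\<lambda>i. env g (L + i)) = env a"
    by (simp add: g env_drop[symmetric])
  then show "length g = L + V \<and> set g \<subseteq> {..<m + 2} \<and>
     (\<exists>\<psi>\<in>subforms \<phi>. code_at 0 \<psi> (env g) \<and> X (form_kind m (\<lambda>i. env g (L + i)) \<psi>))"
    using gate_tuple_props[OF a, of \<psi>] \<psi> X g by (auto simp: code_at_iff intro!: bexI[of _ \<psi>])
next
  fix g \<psi> assume len: "length g = L + V" and "set g \<subseteq> {..<m + 2}" and \<psi>: "\<psi> \<in> subforms \<phi>"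
    and "code_at 0 \<psi> (env g)" and X: "X (form_kind m (\<lambda>i. env g (L + i)) \<psi>)"
  then obtain a where g: "g = code \<psi> @ a" and a: "a \<in> assigns m"
    using gate_tupleE[of g m \<psi>] by (auto simp: code_at_iff)
  have "(\<lambda>i. env g (L + i)) = env a"
    by (simp add: g env_drop[symmetric])
  then show "g \<in> gates (C m) \<and> X (kind (C m) g)"
    using X \<psi> a g by simp
qed

lemma fo_definable_kind:
  assumes "\<forall>i. K \<noteq> InputG i"
  shows "fo_definable (L + V) (\<lambda>m. {g \<in> gates (C m). kind (C m) g = K})"
  by (rule fo_definableI[OF _ kind_set_eq])
    (intro ndef_bex ndef_conj ndef_code_at ndef_form_kind assms finite_subforms)

lemma fo_definable_gates: "fo_definable (L + V) (\<lambda>m. gates (C m))"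
proof (rule fo_definableI)
  show "gates (C m) = {xs. length xs = L + V \<and> set xs \<subseteq> {..<m + 2} \<and>
     (\<exists>\<psi>\<in>subforms \<phi>. code_at 0 \<psi> (env xs))}" for m
    using kind_set_eq[of m "\<lambda>_. True"] by simp
  show "ndef (\<lambda>m v. \<exists>\<psi>\<in>subforms \<phi>. code_at 0 \<psi> v)"
    by (intro ndef_bex ndef_code_at finite_subforms)
qed

lemma fo_definable_inputs:
  "fo_definable (L + V + 1) (\<lambda>m. {g @ [i] | g i. g \<in> gates (C m) \<and> kind (C m) g = InputG i})"
proof (rule fo_definableI)
  \<comment> \<open>Only \<open>WBit x\<close> yields input gates, and the bit read is the value of
    \<open>x\<close>, at component \<open>L + x\<close>. The appended index is component
    \<open>L + V\<close>.\<close>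
  let ?P = "\<lambda>m v. \<exists>\<psi>\<in>subforms \<phi>. \<exists>x\<in>{..<V}.
      \<psi> = WBit x \<and> code_at 0 \<psi> v \<and> v (L + x) < m \<and> v (L + x) = v (L + V)"
  show "ndef ?P"
    by (intro ndef_bex ndef_conj ndef_const ndef_code_at ndef_less_length ndef_eq) simp_all
  show "{g @ [i] | g i. g \<in> gates (C m) \<and> kind (C m) g = InputG i} =
    {xs. length xs = L + V + 1 \<and> set xs \<subseteq> {..<m + 2} \<and> ?P m (env xs)}" for m
  proof (intro set_eqI iffI)
    fix xs assume "xs \<in> {g @ [i] | g i. g \<in> gates (C m) \<and> kind (C m) g = InputG i}"
    then obtain g i where xs: "xs = g @ [i]" and "g \<in> gates (C m)" and k: "kind (C m) g = InputG i"
      by blast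
    then obtain \<psi> a where g: "g = code \<psi> @ a" and \<psi>: "\<psi> \<in> subforms \<phi>" and a: "a \<in> assigns m"
      by (elim gateE)
    have "form_kind m (env a) \<psi> = InputG i" using k g \<psi> by simp
    then obtain x where x: "\<psi> = WBit x" "env a x = i" "i < m"
      by (cases \<psi>) (auto split: if_splits)
    moreover have "x < V" using bit_var_bound \<psi> x by simp
    moreover have "env xs (L + x) = env a x" "env xs (L + V) = i"
      using a \<open>x < V\<close> by (auto simp: xs g env_def assigns_def nth_append)
    moreover have "code_at 0 \<psi> (env xs)" by (simp add: code_at_iff xs g)
    ultimately have "?P m (env xs)"
      using \<psi> by (intro bexI[of _ \<psi>] bexI[of _ x]) auto
    then show "xs \<in> {xs. length xs = L + V + 1 \<and> set xs \<subseteq> {..<m + 2} \<and> ?P m (env xs)}"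
      using gate_tuple_props[OF a, of \<psi>] x by (auto simp: xs g)
  next
    fix xs assume *: "xs \<in> {xs. length xs = L + V + 1 \<and> set xs \<subseteq> {..<m + 2} \<and> ?P m (env xs)}"
    then obtain g i where xs: "xs = g @ [i]" by (cases xs rule: rev_cases) auto
    obtain x where \<psi>: "WBit x \<in> subforms \<phi>" and x: "x < V"
      and c: "code_at 0 (WBit x) (env xs)" and e: "env xs (L + x) < m" "env xs (L + x) = env xs (L + V)"
      using * by blast
    obtain a where g: "g = code (WBit x) @ a" and a: "a \<in> assigns m"
      using * c gate_tupleE[of g m "WBit x"] by (auto simp: xs code_at_iff)
    have "env xs (L + x) = env a x" "env xs (L + V) = i"
      using a x by (auto simp: xs g env_def assigns_def nth_append)
    then have "kind (C m) g = InputG i" using \<psi> e by (simp add: g)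
    moreover have "g \<in> gates (C m)" using \<psi> a by (simp add: g)
    ultimately show "xs \<in> {g @ [i] | g i. g \<in> gates (C m) \<and> kind (C m) g = InputG i}"
      using xs by blast
  qed
qed

lemma fo_definable_wires:
  "fo_definable (L + V + (L + V)) (\<lambda>m. {g @ h | g h. (g, h) \<in> wires (C m)})"
proof (rule fo_definableI)
  \<comment> \<open>The second gate starts at component \<open>L + V\<close>, hence its assignment
    at \<open>L + V + L\<close>.\<close>
  let ?P = "\<lambda>m v. \<exists>\<psi>\<in>subforms \<phi>. \<exists>\<chi>\<in>subforms \<phi>. \<psi> \<in> children \<chi> \<and>
      code_at 0 \<psi> v \<and> code_at (L + V) \<chi> v \<and>
      (\<forall>i\<in>{..<V} - quant_vars \<chi>. v (L + i) = v (L + V + L + i))"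
  show "ndef ?P"
    by (intro ndef_bex ndef_conj ndef_const ndef_code_at ndef_ball ndef_eq) simp_all
  show "{g @ h | g h. (g, h) \<in> wires (C m)} =
    {xs. length xs = L + V + (L + V) \<and> set xs \<subseteq> {..<m + 2} \<and> ?P m (env xs)}" for m
  proof (intro set_eqI iffI)
    fix xs assume "xs \<in> {g @ h | g h. (g, h) \<in> wires (C m)}"
    then obtain \<psi> a \<chi> b where xs: "xs = (code \<psi> @ a) @ (code \<chi> @ b)"
      and \<psi>: "\<psi> \<in> subforms \<phi>" and \<chi>: "\<chi> \<in> subforms \<phi>"
      and a: "a \<in> assigns m" and b: "b \<in> assigns m" and w: "wired a \<psi> b \<chi>"
      by (auto simp: C_def)
    have e: "env xs (L + i) = env a i" "env xs (L + V + L + i) = env b i" if "i < V" for i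
      using that a b by (auto simp: xs env_def assigns_def nth_append)
    have "code_at 0 \<psi> (env xs)" "code_at (L + V) \<chi> (env xs)"
      using a b by (auto simp: xs code_at_iff assigns_def)
    then have "?P m (env xs)"
      using w \<psi> \<chi> e unfolding wired_def by auto
    then show "xs \<in> {xs. length xs = L + V + (L + V) \<and> set xs \<subseteq> {..<m + 2} \<and> ?P m (env xs)}"
      using gate_tuple_props[OF a, of \<psi>] gate_tuple_props[OF b, of \<chi>] by (auto simp: xs)
  next
    fix xs assume *: "xs \<in> {xs. length xs = L + V + (L + V) \<and> set xs \<subseteq> {..<m + 2} \<and> ?P m (env xs)}"
    define g h where "g = take (L + V) xs" and "h = drop (L + V) xs"
    then have xs: "xs = g @ h" "length g = L + V" "length h = L + V"
      using * by auto
    obtain \<psi> \<chi> where \<psi>: "\<psi> \<in> subforms \<phi>" and \<chi>: "\<chi> \<in> subforms \<phi>" and ch: "\<psi> \<in> children \<chi>"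
      and c: "code_at 0 \<psi> (env xs)" "code_at (L + V) \<chi> (env xs)"
      and eq: "\<forall>i\<in>{..<V} - quant_vars \<chi>. env xs (L + i) = env xs (L + V + L + i)"
      using * by blast
    obtain a where g: "g = code \<psi> @ a" and a: "a \<in> assigns m"
      using * c(1) gate_tupleE[of g m \<psi>] xs by (auto simp: code_at_iff)
    obtain b where h: "h = code \<chi> @ b" and b: "b \<in> assigns m"
      using * c(2) gate_tupleE[of h m \<chi>] xs by (auto simp: code_at_iff)
    have e: "env xs (L + i) = env a i" "env xs (L + V + L + i) = env b i" if "i < V" for i
      using that a b by (auto simp: xs g h env_def assigns_def nth_append)
    have "wired a \<psi> b \<chi>" using ch eq e unfolding wired_def by auto
    then have "(g, h) \<in> wires (C m)" using \<psi> \<chi> a b by (auto simp: C_def g h)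
    then show "xs \<in> {g @ h | g h. (g, h) \<in> wires (C m)}" using xs by blast
  qed
qed

lemma fo_definable_out: "fo_definable (L + V) (\<lambda>m. {outgate (C m)})"
proof (rule fo_definableI)
  let ?P = "\<lambda>m v. code_at 0 \<phi> v \<and> (\<forall>i\<in>{..<V}. v (L + i) = 0)"
  show "ndef (\<lambda>m::nat. ?P m)"
    by (intro ndef_conj ndef_code_at ndef_ball ndef_zero) simp
  show "{outgate (C m)} = {xs. length xs = L + V \<and> set xs \<subseteq> {..<m + 2} \<and> ?P m (env xs)}" for m
  proof (intro set_eqI iffI)
    fix xs assume "xs \<in> {outgate (C m)}"
    then have xs: "xs = code \<phi> @ replicate V 0" by (simp add: C_def)
    have "replicate V 0 \<in> assigns m" by (auto simp: assigns_def)
    from gate_tuple_props[OF this, of \<phi>]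
    show "xs \<in> {xs. length xs = L + V \<and> set xs \<subseteq> {..<m + 2} \<and> ?P m (env xs)}"
      by (auto simp: xs code_at_iff env_def nth_append)
  next
    fix xs assume *: "xs \<in> {xs. length xs = L + V \<and> set xs \<subseteq> {..<m + 2} \<and> ?P m (env xs)}"
    then have "length xs = L + V" "set xs \<subseteq> {..<m + 2}" "take L xs = code \<phi>"
      by (auto simp: code_at_iff)
    then obtain a where xs: "xs = code \<phi> @ a" and a: "a \<in> assigns m"
      by (rule gate_tupleE)
    have "a = replicate V 0"
      using * a by (intro nth_equalityI) (auto simp: xs assigns_def env_def nth_append)
    then show "xs \<in> {outgate (C m)}" by (simp add: C_def xs)
  qed
qed

lemma fo_uniform_C: "fo_uniform C"
  unfolding fo_uniform_def
  using fo_definable_gates fo_definable_kind fo_definable_inputs fo_definable_wires fo_definable_out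
  by (intro exI[of _ "L + V"] conjI) auto

end

theorem in_AC0_if_wform:
  assumes "\<And>x w. x \<in> P \<Longrightarrow> w \<in> enc x \<Longrightarrow> wsat w (\<lambda>_. 0) \<phi> \<longleftrightarrow> x \<in> Y"
  shows "in_AC0 enc P Y"
proof -
  obtain us where us: "set us = subforms \<phi>" "distinct us"
    using finite_distinct_list[OF finite_subforms] by blast
  obtain V where V: "wvars \<phi> \<subseteq> {..<V}"
    using finite_nat_set_iff_bounded[of "wvars \<phi>"] by auto
  interpret compiled \<phi> us V
    using us V by unfold_locales
  \<comment> \<open>The estimate \<open>m + 2 \<le> 2 * (m + 1)\<close> costs the factor
    \<open>2 ^ V\<close>; \<open>V\<close> is added because one number has to serve both as
    coefficient and as exponent.\<close>
  let ?c = "card (subforms \<phi>) * 2 ^ V + V"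
  have "card (gates (C m)) \<le> ?c * (m + 1) ^ ?c" for m
  proof -
    have "card (gates (C m)) \<le> card (subforms \<phi>) * (m + 2) ^ V" by (rule card_gates)
    also have "\<dots> \<le> card (subforms \<phi>) * (2 * (m + 1)) ^ V"
      by (intro mult_left_mono power_mono) auto
    also have "\<dots> = card (subforms \<phi>) * 2 ^ V * (m + 1) ^ V"
      by (simp only: power_mult_distrib mult.assoc)
    also have "\<dots> \<le> ?c * (m + 1) ^ ?c"
      by (intro mult_mono power_increasing) auto
    finally show ?thesis .
  qed
  then show ?thesis
    unfolding in_AC0_def using fo_uniform_C wf_circuit_C circuit_depth_C accepts_C assms
    by (intro exI[of _ C] exI[of _ "size \<phi>"] exI[of _ ?c]) simp
qed


section \<open>Definable properties of words that represent ABoxes\<close>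

definition wdef :: "(bool list \<Rightarrow> (nat \<Rightarrow> nat) \<Rightarrow> bool) \<Rightarrow> bool" where
  "wdef P \<longleftrightarrow> (\<exists>\<phi>. \<forall>w v. wsat w v \<phi> \<longleftrightarrow> P w v)"

lemma wdef_neg: assumes "wdef P" shows "wdef (\<lambda>w v. \<not> P w v)"
proof -
  obtain \<phi> where "\<And>w v. wsat w v \<phi> \<longleftrightarrow> P w v"
    using assms unfolding wdef_def by blast
  then show ?thesis unfolding wdef_def by (intro exI[of _ "WNeg \<phi>"]) simp
qed

lemma wdef_conj: assumes "wdef P" "wdef Q" shows "wdef (\<lambda>w v. P w v \<and> Q w v)"
proof -
  obtain \<phi> \<psi> where "\<And>w v. wsat w v \<phi> \<longleftrightarrow> P w v" "\<And>w v. wsat w v \<psi> \<longleftrightarrow> Q w v"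
    using assms unfolding wdef_def by blast
  then show ?thesis unfolding wdef_def by (intro exI[of _ "WConj \<phi> \<psi>"]) simp
qed

lemma wdef_disj: "wdef P \<Longrightarrow> wdef Q \<Longrightarrow> wdef (\<lambda>w v. P w v \<or> Q w v)"
  using wdef_neg[OF wdef_conj[OF wdef_neg[of P] wdef_neg[of Q]]] by simp

lemma wdef_imp: "wdef P \<Longrightarrow> wdef Q \<Longrightarrow> wdef (\<lambda>w v. P w v \<longrightarrow> Q w v)"
  unfolding imp_conv_disj by (intro wdef_disj wdef_neg)

lemma wdef_eq: "wdef (\<lambda>w v. v i = v j)"
  unfolding wdef_def by (intro exI[of _ "WNum (NEq i j)"]) simp

lemma wdef_less: "wdef (\<lambda>w v. v i < v j)"
  unfolding wdef_def by (intro exI[of _ "WNum (NLess i j)"]) simp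

lemma wdef_le: "wdef (\<lambda>w v. v i \<le> v j)"
  using wdef_neg[OF wdef_less[of j i]] by (simp add: not_less)

lemma wdef_plus: "wdef (\<lambda>w v. v i + v j = v k)"
  unfolding wdef_def by (intro exI[of _ "WNum (NPlus i j k)"]) simp

lemma wdef_one: "wdef (\<lambda>w v. v i = 1)"
  unfolding wdef_def
  by (intro exI[of _ "WNum (NConj (NTimes i i i) (NNeg (NPlus i i i)))"]) auto

lemma wdef_zero: "wdef (\<lambda>w v. v i = 0)"
  using wdef_plus[of i i i] by simp

lemma wdef_const: "wdef (\<lambda>w v. b)"
  using wdef_eq[of 0 0] wdef_neg[OF wdef_eq[of 0 0]] by (cases b) simp_all

lemma wdef_ball: "finite I \<Longrightarrow> (\<And>i. i \<in> I \<Longrightarrow> wdef (P i)) \<Longrightarrow> wdef (\<lambda>w v. \<forall>i\<in>I. P i w v)"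
  by (induction I rule: finite_induct) (simp_all add: wdef_const wdef_conj)

lemma wdef_bex: "finite I \<Longrightarrow> (\<And>i. i \<in> I \<Longrightarrow> wdef (P i)) \<Longrightarrow> wdef (\<lambda>w v. \<exists>i\<in>I. P i w v)"
  using wdef_neg[OF wdef_ball[of I "\<lambda>i w v. \<not> P i w v"]] wdef_neg by simp

text \<open>\<open>P\<close> receives the quantified value as an argument of its own, and freshness
  says that it does not look it up at \<open>x\<close>. Uses choose \<open>x\<close> above all
  indices in play, such as \<open>Suc (i + j)\<close>.\<close>

lemma wdef_ex:
  assumes "wdef (\<lambda>w v. P w v (v x))" and fresh: "\<And>w v a b. P w (v(x := b)) a = P w v a"
  shows "wdef (\<lambda>w v. \<exists>a<length w + 2. P w v a)"
proof -
  obtain \<phi> where \<phi>: "\<And>w v. wsat w v \<phi> \<longleftrightarrow> P w v (v x)"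
    using assms(1) unfolding wdef_def by blast
  then have "wsat w v (WEx x \<phi>) \<longleftrightarrow> (\<exists>a<length w + 2. P w v a)" for w v
    by (simp add: \<phi> fresh)
  then show ?thesis unfolding wdef_def by blast
qed

lemma wdef_all:
  assumes "wdef (\<lambda>w v. P w v (v x))" and "\<And>w v a b. P w (v(x := b)) a = P w v a"
  shows "wdef (\<lambda>w v. \<forall>a<length w + 2. P w v a)"
  using wdef_neg[OF wdef_ex[of "\<lambda>w v a. \<not> P w v a", OF wdef_neg]] assms by simp

lemma wdef_Suc: "wdef (\<lambda>w v. v j = Suc (v i))"
proof -
  have "wdef (\<lambda>w v. \<exists>a<length w + 2. a = 1 \<and> v i + a = v j)"
    by (rule wdef_ex[where x = "Suc (i + j)"]) (intro wdef_conj wdef_one wdef_plus, simp)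
  then show ?thesis by (simp add: eq_commute)
qed

section \<open>Locating names and facts in a word\<close>

definition bit_at :: "bool list \<Rightarrow> bool \<Rightarrow> nat \<Rightarrow> bool" where
  "bit_at w b i \<longleftrightarrow> i < length w \<and> w ! i = b"

lemma wdef_bit_at: "wdef (\<lambda>w v. bit_at w b (v i))"
proof -
  have 1: "wdef (\<lambda>w v. v i < length w \<and> w ! v i)"
    unfolding wdef_def by (intro exI[of _ "WBit i"]) simp
  \<comment> \<open>A bit equal to \<open>False\<close> must be told apart from a position outside
    the word. As before, being inside means having two larger elements in the segment.\<close>
  have "wdef (\<lambda>w v. \<exists>a<length w + 2. \<exists>b<length w + 2. v i < a \<and> a < b)"
    by (rule wdef_ex[where x = "Suc i"], rule wdef_ex[where x = "Suc (Suc i)"])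
      (intro wdef_conj wdef_less, simp_all)
  moreover have "(\<exists>a<n + 2. \<exists>b<n + 2. k < a \<and> a < b) \<longleftrightarrow> k < n" for k n :: nat
    by presburger
  ultimately have 2: "wdef (\<lambda>w v. v i < length w)" by simp
  show ?thesis
    using 1 wdef_conj[OF 2 wdef_neg[OF 1]] unfolding bit_at_def
    by (cases b) (auto elim: back_subst[of wdef] intro!: ext)
qed

text \<open>From here on positions count two-bit symbols, which keeps every test aligned.\<close>

definition sym_at :: "bool list \<Rightarrow> bool \<Rightarrow> bool \<Rightarrow> nat \<Rightarrow> bool" where
  "sym_at w b c i \<longleftrightarrow> bit_at w b (2 * i) \<and> bit_at w c (2 * i + 1)"

lemma wdef_sym_at: "wdef (\<lambda>w v. sym_at w b c (v i))"
proof -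
  have "sym_at w b c k \<longleftrightarrow> (\<exists>x<length w + 2. \<exists>y<length w + 2. k + k = x \<and> y = Suc x \<and>
      bit_at w b x \<and> bit_at w c y)" for w k
    by (auto simp: sym_at_def bit_at_def mult_2)
  moreover have "wdef (\<lambda>w v. \<exists>x<length w + 2. \<exists>y<length w + 2. v i + v i = x \<and> y = Suc x \<and>
      bit_at w b x \<and> bit_at w c y)"
    by (rule wdef_ex[where x = "Suc i"], rule wdef_ex[where x = "Suc (Suc i)"])
      (intro wdef_conj wdef_plus wdef_Suc wdef_bit_at, simp_all)
  ultimately show ?thesis by simp
qed

text \<open>The symbols \<open>(False, b)\<close> are letters, \<open>(True, False)\<close> ends a
  name and \<open>(True, True)\<close> ends a fact. \<open>e\<close> is the position of the end
  symbol itself.\<close>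

definition name_end :: "bool list \<Rightarrow> nat \<Rightarrow> nat \<Rightarrow> bool" where
  "name_end w i e \<longleftrightarrow> sym_at w True False e \<and> i \<le> e \<and>
     (\<forall>x<length w + 2. i \<le> x \<and> x < e \<longrightarrow> sym_at w False False x \<or> sym_at w False True x)"

lemma wdef_name_end: "wdef (\<lambda>w v. name_end w (v i) (v j))"
proof -
  have "wdef (\<lambda>w v. \<forall>x<length w + 2. v i \<le> x \<and> x < v j \<longrightarrow>
      sym_at w False False x \<or> sym_at w False True x)"
    by (rule wdef_all[where x = "Suc (i + j)"])
      (intro wdef_imp wdef_conj wdef_disj wdef_le wdef_less wdef_sym_at, simp)
  then show ?thesis
    unfolding name_end_def by (intro wdef_conj wdef_le wdef_sym_at)
qed

text \<open>The position behind the last fact qualifies too; it drops out when a name is required to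
  begin there.\<close>

definition fact_start :: "bool list \<Rightarrow> nat \<Rightarrow> bool" where
  "fact_start w i \<longleftrightarrow> i = 0 \<or> (\<exists>p<length w + 2. i = Suc p \<and> sym_at w True True p)"

lemma wdef_fact_start: "wdef (\<lambda>w v. fact_start w (v i))"
proof -
  have "wdef (\<lambda>w v. \<exists>p<length w + 2. v i = Suc p \<and> sym_at w True True p)"
    by (rule wdef_ex[where x = "Suc i"]) (intro wdef_conj wdef_Suc wdef_sym_at, simp)
  then show ?thesis
    unfolding fact_start_def by (intro wdef_disj wdef_zero)
qed

definition next_name :: "bool list \<Rightarrow> nat \<Rightarrow> nat \<Rightarrow> bool" where
  "next_name w i j \<longleftrightarrow> (\<exists>e<length w + 2. name_end w i e \<and> j = Suc e)"

definition fact_end :: "bool list \<Rightarrow> nat \<Rightarrow> bool" where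
  "fact_end w i \<longleftrightarrow> (\<exists>t<length w + 2. next_name w i t \<and> sym_at w True True t)"

text \<open>The two kinds of facts differ only in the number of names before the end symbol. The
  arguments are the starting positions of these names.\<close>

definition cfact_at :: "bool list \<Rightarrow> nat \<Rightarrow> nat \<Rightarrow> bool" where
  "cfact_at w i j \<longleftrightarrow> fact_start w i \<and> next_name w i j \<and> fact_end w j"

definition rfact_at :: "bool list \<Rightarrow> nat \<Rightarrow> nat \<Rightarrow> nat \<Rightarrow> bool" where
  "rfact_at w i j k \<longleftrightarrow> fact_start w i \<and> next_name w i j \<and> next_name w j k \<and> fact_end w k"

lemma wdef_next_name: "wdef (\<lambda>w v. next_name w (v i) (v j))"
  unfolding next_name_def
  by (rule wdef_ex[where x = "Suc (i + j)"]) (intro wdef_conj wdef_Suc wdef_name_end, simp)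

lemma wdef_fact_end: "wdef (\<lambda>w v. fact_end w (v i))"
  unfolding fact_end_def
  by (rule wdef_ex[where x = "Suc i"]) (intro wdef_conj wdef_sym_at wdef_next_name, simp)

lemma wdef_cfact_at: "wdef (\<lambda>w v. cfact_at w (v i) (v j))"
  unfolding cfact_at_def by (intro wdef_conj wdef_fact_start wdef_next_name wdef_fact_end)

lemma wdef_rfact_at: "wdef (\<lambda>w v. rfact_at w (v i) (v j) (v k))"
  unfolding rfact_at_def by (intro wdef_conj wdef_fact_start wdef_next_name wdef_fact_end)

definition same_sym :: "bool list \<Rightarrow> nat \<Rightarrow> nat \<Rightarrow> bool" where
  "same_sym w i j \<longleftrightarrow> (\<exists>b\<in>UNIV. \<exists>c\<in>UNIV. sym_at w b c i \<and> sym_at w b c j)"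

lemma wdef_same_sym: "wdef (\<lambda>w v. same_sym w (v i) (v j))"
  unfolding same_sym_def by (intro wdef_bex wdef_conj wdef_sym_at) simp_all

text \<open>The comparison includes the end symbol at \<open>e\<close>, so a longer name that merely
  begins with the same letters is rejected. The offset \<open>d\<close> is passed through sums
  because the language relates positions only by arithmetic on variables.\<close>

definition same_name :: "bool list \<Rightarrow> nat \<Rightarrow> nat \<Rightarrow> bool" where
  "same_name w i j \<longleftrightarrow> (\<exists>e<length w + 2. name_end w i e \<and>
     (\<forall>d<length w + 2. \<forall>x<length w + 2. i + d = x \<and> x \<le> e \<longrightarrow>
        (\<exists>y<length w + 2. j + d = y \<and> same_sym w x y)))"

lemma wdef_same_name: "wdef (\<lambda>w v. same_name w (v i) (v j))"
proof -
  let ?x = "Suc (i + j)"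
  show ?thesis
    unfolding same_name_def
    by (rule wdef_ex[where x = ?x], intro wdef_conj wdef_name_end,
        rule wdef_all[where x = "Suc ?x"], rule wdef_all[where x = "Suc (Suc ?x)"],
        intro wdef_imp wdef_conj wdef_plus wdef_le,
        rule wdef_ex[where x = "Suc (Suc (Suc ?x))"])
      (intro wdef_conj wdef_plus wdef_same_sym, simp_all)
qed

text \<open>Here \<open>c\<close> is a fixed name, so the recursion unfolds to a formula whose size
  depends on \<open>c\<close> alone.\<close>

primrec name_at :: "bool list \<Rightarrow> name \<Rightarrow> nat \<Rightarrow> bool" where
  "name_at w [] i \<longleftrightarrow> sym_at w True False i"
| "name_at w (b # c) i \<longleftrightarrow>
     sym_at w False b i \<and> (\<exists>j<length w + 2. j = Suc i \<and> name_at w c j)"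

lemma wdef_name_at: "wdef (\<lambda>w v. name_at w c (v i))"
proof (induction c arbitrary: i)
  case Nil
  then show ?case by (simp add: wdef_sym_at)
next
  case (Cons b c)
  have "wdef (\<lambda>w v. \<exists>j<length w + 2. j = Suc (v i) \<and> name_at w c j)"
    by (rule wdef_ex[where x = "Suc i"]) (intro wdef_conj wdef_Suc Cons, simp)
  then show ?case unfolding name_at.simps by (intro wdef_conj wdef_sym_at)
qed

section \<open>Words as lists of two-bit symbols\<close>

type_synonym symbol = "bool \<times> bool"

definition bits :: "symbol list \<Rightarrow> bool list" where
  "bits \<sigma> = concat (map (\<lambda>(b, c). [b, c]) \<sigma>)"

definition sym_name :: "name \<Rightarrow> symbol list" where
  "sym_name c = map (Pair False) c @ [(True, False)]"

fun sym_fact :: "fact \<Rightarrow> symbol list" where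
  "sym_fact (CFact A a) = sym_name A @ sym_name a @ [(True, True)]"
| "sym_fact (RFact r a b) = sym_name r @ sym_name a @ sym_name b @ [(True, True)]"

lemma bits_simps [simp]:
  "bits [] = []" "bits ((b, c) # \<sigma>) = b # c # bits \<sigma>" "bits (\<sigma> @ \<tau>) = bits \<sigma> @ bits \<tau>"
  by (simp_all add: bits_def)

lemma length_bits [simp]: "length (bits \<sigma>) = 2 * length \<sigma>"
  by (induction \<sigma>) auto

lemma bits_sym_name: "bits (sym_name c) = code_name c"
proof -
  have "bits (map (Pair False) c) = concat (map (\<lambda>b. [False, b]) c)"
    by (induction c) auto
  then show ?thesis by (simp add: sym_name_def code_name_def)
qed

lemma bits_sym_fact: "bits (sym_fact f) = code_fact f"
  by (cases f) (simp_all add: bits_sym_name)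

lemma bits_concat: "bits (concat (map sym_fact fs)) = concat (map code_fact fs)"
  by (induction fs) (simp_all add: bits_sym_fact)

lemma sym_at_bits: "sym_at (bits \<sigma>) b c i \<longleftrightarrow> i < length \<sigma> \<and> \<sigma> ! i = (b, c)"
proof (induction \<sigma> arbitrary: i)
  case Nil
  then show ?case by (simp add: sym_at_def bit_at_def)
next
  case (Cons s \<sigma>)
  obtain b' c' where s: "s = (b', c')" by fastforce
  show ?case
  proof (cases i)
    case 0
    then show ?thesis by (auto simp: s sym_at_def bit_at_def)
  next
    case (Suc i')
    then show ?thesis using Cons[of i'] by (auto simp: s sym_at_def bit_at_def)
  qed
qed

definition occurs :: "symbol list \<Rightarrow> symbol list \<Rightarrow> nat \<Rightarrow> bool" where
  "occurs \<sigma> xs i \<longleftrightarrow> (\<exists>rest. drop i \<sigma> = xs @ rest)"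

lemma occurs_iff: "occurs \<sigma> xs i \<longleftrightarrow> (\<forall>d<length xs. i + d < length \<sigma> \<and> \<sigma> ! (i + d) = xs ! d)"
proof
  assume "occurs \<sigma> xs i"
  then obtain rest where r: "drop i \<sigma> = xs @ rest" by (auto simp: occurs_def)
  show "\<forall>d<length xs. i + d < length \<sigma> \<and> \<sigma> ! (i + d) = xs ! d"
  proof (intro allI impI)
    fix d assume d: "d < length xs"
    have "length (drop i \<sigma>) = length xs + length rest" by (simp add: r)
    then have l: "i + d < length \<sigma>" using d by auto
    then have "\<sigma> ! (i + d) = drop i \<sigma> ! d" by simp
    then show "i + d < length \<sigma> \<and> \<sigma> ! (i + d) = xs ! d" using l d by (simp add: r nth_append)
  qed
next
  assume *: "\<forall>d<length xs. i + d < length \<sigma> \<and> \<sigma> ! (i + d) = xs ! d"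
  have "take (length xs) (drop i \<sigma>) = xs"
  proof (rule nth_equalityI)
    show "length (take (length xs) (drop i \<sigma>)) = length xs"
    proof (cases xs)
      case (Cons x ys)
      then have "i + length ys < length \<sigma>" using *[rule_format, of "length ys"] by simp
      then show ?thesis using Cons by (auto simp: min_def)
    qed simp
  next
    fix d assume "d < length (take (length xs) (drop i \<sigma>))"
    then have "d < length xs" "i \<le> length \<sigma>" by auto
    then show "take (length xs) (drop i \<sigma>) ! d = xs ! d" using * by simp
  qed
  then show "occurs \<sigma> xs i"
    unfolding occurs_def using append_take_drop_id[of "length xs" "drop i \<sigma>"] by metis
qed

lemma occurs_append: "occurs \<sigma> (xs @ ys) i \<longleftrightarrow> occurs \<sigma> xs i \<and> occurs \<sigma> ys (i + length xs)"
proof -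
  have "(\<forall>d<length (xs @ ys). Q d ((xs @ ys) ! d)) \<longleftrightarrow>
      (\<forall>d<length xs. Q d (xs ! d)) \<and> (\<forall>d<length ys. Q (length xs + d) (ys ! d))"
    (is "?l \<longleftrightarrow> ?r") for Q :: "nat \<Rightarrow> symbol \<Rightarrow> bool"
  proof
    assume l: ?l
    have "Q d (xs ! d)" if "d < length xs" for d
      using l[rule_format, of d] that by (simp add: nth_append)
    moreover have "Q (length xs + d) (ys ! d)" if "d < length ys" for d
      using l[rule_format, of "length xs + d"] that by simp
    ultimately show ?r by blast
  next
    assume r: ?r
    show ?l
    proof (intro allI impI)
      fix d assume "d < length (xs @ ys)"
      then show "Q d ((xs @ ys) ! d)"
        using r[THEN conjunct1, rule_format, of d] r[THEN conjunct2, rule_format, of "d - length xs"]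
        by (cases "d < length xs") (auto simp: nth_append)
    qed
  qed
  from this[of "\<lambda>d s. i + d < length \<sigma> \<and> \<sigma> ! (i + d) = s"] show ?thesis
    by (simp only: occurs_iff add.assoc)
qed

lemma occurs_single: "occurs \<sigma> [s] i \<longleftrightarrow> i < length \<sigma> \<and> \<sigma> ! i = s"
  by (simp add: occurs_iff)

lemma occurs_Cons: "occurs \<sigma> (s # xs) i \<longleftrightarrow> i < length \<sigma> \<and> \<sigma> ! i = s \<and> occurs \<sigma> xs (Suc i)"
  using occurs_append[of \<sigma> "[s]" xs i] by (simp add: occurs_single)

lemma name_at_bits: "name_at (bits \<sigma>) c i \<longleftrightarrow> occurs \<sigma> (sym_name c) i"
proof (induction c arbitrary: i)
  case Nil
  then show ?case by (simp add: sym_name_def occurs_single sym_at_bits)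
next
  case (Cons b c)
  have "sym_name (b # c) = (False, b) # sym_name c" by (simp add: sym_name_def)
  then show ?case
    by (auto simp: occurs_Cons sym_at_bits Cons.IH simp del: length_bits) simp_all
qed

text \<open>The end symbol makes the codes of names prefix-free; hence at most one name begins at a
  given position.\<close>

lemma sym_name_prefix_unique: "sym_name c @ r = sym_name d @ s \<Longrightarrow> c = d \<and> r = s"
proof (induction c arbitrary: d)
  case Nil
  then show ?case by (cases d) (auto simp: sym_name_def)
next
  case (Cons b c)
  then obtain d' where "d = b # d'" by (cases d) (auto simp: sym_name_def)
  then show ?case using Cons by (auto simp: sym_name_def)
qed

lemma occurs_name_unique: "occurs \<sigma> (sym_name c) i \<Longrightarrow> occurs \<sigma> (sym_name d) i \<Longrightarrow> c = d"
  unfolding occurs_def using sym_name_prefix_unique by metis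

lemma length_sym_name [simp]: "length (sym_name c) = Suc (length c)"
  by (simp add: sym_name_def)

lemma name_end_bits:
  "name_end (bits \<sigma>) i e \<longleftrightarrow> (\<exists>c. occurs \<sigma> (sym_name c) i \<and> e = i + length c)"
proof
  assume e: "name_end (bits \<sigma>) i e"
  then have le: "i \<le> e" "e < length \<sigma>" "\<sigma> ! e = (True, False)"
    by (auto simp: name_end_def sym_at_bits)
  \<comment> \<open>All symbols from \<open>i\<close> up to \<open>e\<close> are letters, and the
    second bit of a letter is its content.\<close>
  let ?c = "map snd (take (e - i) (drop i \<sigma>))"
  have len: "length ?c = e - i" using le by simp
  have "\<sigma> ! (i + d) = (False, ?c ! d)" if "d < e - i" for d
  proof -
    have "fst (\<sigma> ! (i + d)) = False"
      using e le that unfolding name_end_def sym_at_bits by (auto dest!: spec[of _ "i + d"])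
    then show ?thesis using that le by (simp add: prod_eq_iff)
  qed
  then have "occurs \<sigma> (sym_name ?c) i"
    unfolding sym_name_def occurs_append using le len
    by (auto simp: occurs_iff)
  then show "\<exists>c. occurs \<sigma> (sym_name c) i \<and> e = i + length c"
    using len le by (intro exI[of _ ?c]) simp
next
  assume "\<exists>c. occurs \<sigma> (sym_name c) i \<and> e = i + length c"
  then obtain c where c: "occurs \<sigma> (map (Pair False) c) i" "occurs \<sigma> [(True, False)] e"
    and e: "e = i + length c"
    unfolding sym_name_def occurs_append by auto
  have "\<sigma> ! x = (False, False) \<or> \<sigma> ! x = (False, True)" if "i \<le> x" "x < e" for x
    using c(1)[unfolded occurs_iff, rule_format, of "x - i"] that e by auto
  then show "name_end (bits \<sigma>) i e"
    using c(2) e unfolding name_end_def sym_at_bits occurs_single by auto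
qed

lemma next_name_bits:
  "next_name (bits \<sigma>) i j \<longleftrightarrow> (\<exists>c. occurs \<sigma> (sym_name c) i \<and> j = i + length (sym_name c))"
proof -
  have "e < length (bits \<sigma>) + 2" if "name_end (bits \<sigma>) i e" for e
    using that by (simp add: name_end_def sym_at_bits)
  then show ?thesis unfolding next_name_def using name_end_bits by auto
qed

lemma fact_end_bits:
  "fact_end (bits \<sigma>) i \<longleftrightarrow> (\<exists>c. occurs \<sigma> (sym_name c @ [(True, True)]) i)"
proof -
  have "fact_end (bits \<sigma>) i \<longleftrightarrow> (\<exists>t. next_name (bits \<sigma>) i t \<and> t < length \<sigma> \<and> \<sigma> ! t = (True, True))"
    unfolding fact_end_def sym_at_bits by (intro iffI; elim exE; rule_tac x = t in exI) simp_all
  then show ?thesis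
    unfolding next_name_bits occurs_append occurs_single by blast
qed

lemma fact_start_bits:
  "fact_start (bits \<sigma>) i \<longleftrightarrow> i = 0 \<or> (\<exists>p. i = Suc p \<and> occurs \<sigma> [(True, True)] p)"
  unfolding fact_start_def occurs_single sym_at_bits by auto

text \<open>Once a name is known to begin at \<open>i\<close>, its end is determined, and the test
  reduces to reading the same code at \<open>j\<close>.\<close>

lemma same_name_bits:
  assumes c: "occurs \<sigma> (sym_name c) i"
  shows "same_name (bits \<sigma>) i j \<longleftrightarrow> occurs \<sigma> (sym_name c) j"
proof -
  have e: "name_end (bits \<sigma>) i e \<longleftrightarrow> e = i + length c" for e
    using name_end_bits c occurs_name_unique by metis
  have le: "i + length c < length \<sigma>"
    using c[unfolded occurs_iff, rule_format, of "length c"] by simp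
  have "same_name (bits \<sigma>) i j \<longleftrightarrow>
      (\<forall>d\<le>length c. j + d < length \<sigma> \<and> same_sym (bits \<sigma>) (i + d) (j + d))"
  proof -
    have "same_sym (bits \<sigma>) x y \<Longrightarrow> y < length \<sigma>" for x y
      by (auto simp: same_sym_def sym_at_bits)
    note bound = this
    show ?thesis
    proof
      assume "same_name (bits \<sigma>) i j"
      then have *: "\<exists>y<length (bits \<sigma>) + 2. j + d = y \<and> same_sym (bits \<sigma>) x y"
        if "d < length (bits \<sigma>) + 2" "x < length (bits \<sigma>) + 2" "i + d = x" "x \<le> i + length c"
        for d x
        using that unfolding same_name_def e by blast
      have "same_sym (bits \<sigma>) (i + d) (j + d)" if "d \<le> length c" for d
        using *[of d "i + d"] that le by simp
      then show "\<forall>d\<le>length c. j + d < length \<sigma> \<and> same_sym (bits \<sigma>) (i + d) (j + d)"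
        using bound by blast
    next
      assume *: "\<forall>d\<le>length c. j + d < length \<sigma> \<and> same_sym (bits \<sigma>) (i + d) (j + d)"
      show "same_name (bits \<sigma>) i j"
        unfolding same_name_def e
      proof (rule exI[of _ "i + length c"], intro conjI allI impI refl)
        show "i + length c < length (bits \<sigma>) + 2" using le by simp
        fix d x assume "i + d = x \<and> x \<le> i + length c"
        then show "\<exists>y<length (bits \<sigma>) + 2. j + d = y \<and> same_sym (bits \<sigma>) x y"
          using *[rule_format, of d] by auto
      qed
    qed
  qed
  also have "\<dots> \<longleftrightarrow> (\<forall>d\<le>length c. j + d < length \<sigma> \<and> \<sigma> ! (j + d) = sym_name c ! d)"
  proof -
    have "same_sym (bits \<sigma>) (i + d) (j + d) \<longleftrightarrow> \<sigma> ! (j + d) = sym_name c ! d"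
      if "d \<le> length c" "j + d < length \<sigma>" for d
      using c[unfolded occurs_iff, rule_format, of d] that
      by (cases "sym_name c ! d") (auto simp: same_sym_def sym_at_bits)
    then show ?thesis by blast
  qed
  also have "\<dots> \<longleftrightarrow> occurs \<sigma> (sym_name c) j"
    by (simp add: occurs_iff less_Suc_eq_le)
  finally show ?thesis .
qed

lemma sym_fact_snoc: "\<exists>xs. sym_fact f = xs @ [(True, True)] \<and> (True, True) \<notin> set xs"
  by (cases f) (auto simp: sym_name_def)

lemma sym_fact_terminator:
  assumes "i < length (sym_fact f)" "sym_fact f ! i = (True, True)"
  shows "Suc i = length (sym_fact f)"
proof -
  obtain xs where xs: "sym_fact f = xs @ [(True, True)]" "(True, True) \<notin> set xs"
    using sym_fact_snoc by blast
  have "\<not> i < length xs"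
    using assms(2) xs nth_mem[of i xs] by (metis nth_append)
  then show ?thesis using assms(1) xs by simp
qed

lemma sym_fact_prefix_unique: "sym_fact f @ r = sym_fact g @ s \<Longrightarrow> f = g"
  using code_fact_append_inj[of f "bits r" g "bits s"]
  by (metis bits_simps(3) bits_sym_fact)

text \<open>A start other than 0 follows an end-of-fact symbol, and within the first fact that
  symbol occurs only at the very end. So the start is a boundary of the remaining list, and
  induction applies after shifting.\<close>

lemma parse_fact:
  assumes "fact_start (bits (concat (map sym_fact fs))) i" "occurs (concat (map sym_fact fs)) (sym_fact f) i"
  shows "f \<in> set fs"
  using assms
proof (induction fs arbitrary: i)
  case Nil
  then show ?case by (cases f) (auto simp: occurs_def sym_name_def)
next
  case (Cons g fs)
  let ?\<sigma> = "concat (map sym_fact fs)" and ?l = "length (sym_fact g)"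
  show ?case
  proof (cases "i = 0")
    case True
    then show ?thesis using Cons.prems(2) sym_fact_prefix_unique by (fastforce simp: occurs_def)
  next
    case False
    then obtain p where p: "i = Suc p" "p < length (sym_fact g @ ?\<sigma>)"
      "(sym_fact g @ ?\<sigma>) ! p = (True, True)"
      using Cons.prems(1) unfolding fact_start_bits occurs_single by auto
    have *: "i = ?l \<or> i > ?l \<and> occurs ?\<sigma> [(True, True)] (p - ?l)"
    proof (cases "p < ?l")
      case True
      then show ?thesis using p sym_fact_terminator[of p g] by (auto simp: nth_append)
    next
      case False
      then show ?thesis using p by (auto simp: nth_append occurs_single)
    qed
    then have "fact_start (bits ?\<sigma>) (i - ?l)"
      using p(1) by (auto simp: fact_start_bits)
    moreover have "occurs ?\<sigma> (sym_fact f) (i - ?l)"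
      using Cons.prems(2) * by (auto simp: occurs_def)
    ultimately show ?thesis using Cons.IH by simp
  qed
qed

lemma fact_occurs:
  assumes "f \<in> set fs"
  obtains i where "fact_start (bits (concat (map sym_fact fs))) i"
    "occurs (concat (map sym_fact fs)) (sym_fact f) i"
proof -
  obtain gs hs where fs: "fs = gs @ f # hs" using assms by (meson split_list)
  let ?i = "length (concat (map sym_fact gs))"
  have "fact_start (bits (concat (map sym_fact fs))) ?i"
  proof (cases gs rule: rev_cases)
    case (snoc ys g)
    obtain zs where "sym_fact g = zs @ [(True, True)]" by (cases g) auto
    then show ?thesis
      unfolding fact_start_bits by (auto simp: fs snoc occurs_single nth_append)
  qed (simp add: fact_start_bits)
  moreover have "occurs (concat (map sym_fact fs)) (sym_fact f) ?i"
    by (auto simp: occurs_def fs)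
  ultimately show ?thesis by (rule that)
qed

lemma abox_wordE:
  assumes "w \<in> abox_words A"
  obtains fs where "set fs = A" "w = bits (concat (map sym_fact fs))"
  using assms by (auto simp: abox_words_def bits_concat)

lemma name_at_unique:
  assumes "w \<in> abox_words A" "name_at w c i" "name_at w d i"
  shows "c = d"
  using assms occurs_name_unique by (auto elim!: abox_wordE simp: name_at_bits)

lemma same_name_iff:
  assumes "w \<in> abox_words A" "name_at w c i"
  shows "same_name w i j \<longleftrightarrow> name_at w c j"
  using assms same_name_bits by (auto elim!: abox_wordE simp: name_at_bits)

lemma name_at_bound:
  assumes "name_at w c i"
  shows "i < length w + 2"
  using assms by (cases c) (auto simp: sym_at_def bit_at_def)

lemma cfact_atD:
  assumes "w \<in> abox_words Ab" "cfact_at w i j"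
  shows "\<exists>A a. CFact A a \<in> Ab \<and> name_at w A i \<and> name_at w a j"
proof -
  obtain fs where fs: "set fs = Ab" "w = bits (concat (map sym_fact fs))"
    using assms(1) by (rule abox_wordE)
  let ?\<sigma> = "concat (map sym_fact fs)"
  have "fact_start w i" using assms(2) by (simp add: cfact_at_def)
  moreover obtain A a where f: "occurs ?\<sigma> (sym_fact (CFact A a)) i"
    and "occurs ?\<sigma> (sym_name A) i" "occurs ?\<sigma> (sym_name a) j"
    using assms(2) unfolding fs cfact_at_def next_name_bits fact_end_bits
    by (auto simp: occurs_append)
  ultimately show ?thesis using parse_fact[OF _ f] fs by (auto simp: name_at_bits)
qed

lemma rfact_atD:
  assumes "w \<in> abox_words Ab" "rfact_at w i j k"
  shows "\<exists>r a b. RFact r a b \<in> Ab \<and> name_at w r i \<and> name_at w a j \<and> name_at w b k"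
proof -
  obtain fs where fs: "set fs = Ab" "w = bits (concat (map sym_fact fs))"
    using assms(1) by (rule abox_wordE)
  let ?\<sigma> = "concat (map sym_fact fs)"
  have "fact_start w i" using assms(2) by (simp add: rfact_at_def)
  moreover obtain r a b where f: "occurs ?\<sigma> (sym_fact (RFact r a b)) i"
    and "occurs ?\<sigma> (sym_name r) i" "occurs ?\<sigma> (sym_name a) j" "occurs ?\<sigma> (sym_name b) k"
    using assms(2) unfolding fs rfact_at_def next_name_bits fact_end_bits
    by (auto simp: occurs_append)
  ultimately show ?thesis using parse_fact[OF _ f] fs by (auto simp: name_at_bits)
qed

lemma cfact_atI:
  assumes "w \<in> abox_words Ab" "CFact A a \<in> Ab"
  shows "\<exists>i j. cfact_at w i j \<and> name_at w A i \<and> name_at w a j"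
proof -
  obtain fs where fs: "set fs = Ab" "w = bits (concat (map sym_fact fs))"
    using assms(1) by (rule abox_wordE)
  obtain i where i: "fact_start w i" "occurs (concat (map sym_fact fs)) (sym_fact (CFact A a)) i"
    using fact_occurs[of "CFact A a" fs] fs assms(2) by auto
  then have "cfact_at w i (i + length (sym_name A))"
    unfolding cfact_at_def fs next_name_bits fact_end_bits by (auto simp: occurs_append)
  moreover have "name_at w A i \<and> name_at w a (i + length (sym_name A))"
    using i(2) by (simp add: fs name_at_bits occurs_append)
  ultimately show ?thesis by blast
qed

lemma rfact_atI:
  assumes "w \<in> abox_words Ab" "RFact r a b \<in> Ab"
  shows "\<exists>i j k. rfact_at w i j k \<and> name_at w r i \<and> name_at w a j \<and> name_at w b k"
proof -
  obtain fs where fs: "set fs = Ab" "w = bits (concat (map sym_fact fs))"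
    using assms(1) by (rule abox_wordE)
  obtain i where i: "fact_start w i" "occurs (concat (map sym_fact fs)) (sym_fact (RFact r a b)) i"
    using fact_occurs[of "RFact r a b" fs] fs assms(2) by auto
  let ?j = "i + length (sym_name r)"
  let ?k = "?j + length (sym_name a)"
  have "next_name w i ?j" "next_name w ?j ?k" "fact_end w ?k"
    using i(2) unfolding fs next_name_bits fact_end_bits by (auto simp: occurs_append)
  then have "rfact_at w i ?j ?k"
    unfolding rfact_at_def using i(1) by blast
  moreover have "name_at w r i \<and> name_at w a ?j \<and> name_at w b ?k"
    using i(2) by (simp add: fs name_at_bits occurs_append)
  ultimately show ?thesis by blast
qed


section \<open>Local properties of ABoxes\<close>

fun rename_fact :: "(name \<Rightarrow> name) \<Rightarrow> (name \<Rightarrow> name) \<Rightarrow> (name \<Rightarrow> name) \<Rightarrow> fact \<Rightarrow> fact" where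
  "rename_fact \<gamma> \<rho> \<pi> (CFact A a) = CFact (\<gamma> A) (\<pi> a)"
| "rename_fact \<gamma> \<rho> \<pi> (RFact r a b) = RFact (\<rho> r) (\<pi> a) (\<pi> b)"

text \<open>\<open>X\<close> and its image have equally many elements outside each other. Sending
  the surplus of the image back to the surplus of \<open>X\<close>, and fixing the rest, closes
  \<open>g\<close> up to an injection of the whole type.\<close>

lemma inj_on_extend_inj:
  fixes g :: "'a \<Rightarrow> 'a"
  assumes "finite X" "inj_on g X"
  shows "\<exists>\<pi>. inj \<pi> \<and> (\<forall>x\<in>X. \<pi> x = g x)"
proof -
  let ?Y = "g ` X"
  have "card X = card ?Y" using card_image[OF assms(2)] by simp
  then have "card (?Y - X) = card (X - ?Y)"
    using assms(1) card_Int_Diff[of X ?Y] card_Int_Diff[of ?Y X] by (simp add: Int_commute)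
  then obtain h where h: "bij_betw h (?Y - X) (X - ?Y)"
    using finite_same_card_bij[of "?Y - X" "X - ?Y"] assms(1) by auto
  define \<pi> where "\<pi> x = (if x \<in> X then g x else if x \<in> ?Y then h x else x)" for x
  have 1: "\<pi> x \<in> X - ?Y" if "x \<in> ?Y - X" for x
    using that h by (auto simp: \<pi>_def bij_betw_def)
  have "inj \<pi>"
  proof (rule injI)
    fix x y assume eq: "\<pi> x = \<pi> y"
    have "\<pi> z \<in> ?Y" if "z \<in> X" for z using that by (simp add: \<pi>_def)
    moreover have "\<pi> z \<notin> X \<union> ?Y" if "z \<notin> X \<union> ?Y" for z using that by (simp add: \<pi>_def)
    ultimately consider "x \<in> X" "y \<in> X" | "x \<in> ?Y - X" "y \<in> ?Y - X"
      | "x \<notin> X \<union> ?Y" "y \<notin> X \<union> ?Y"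
      using 1 eq by (metis Diff_iff Un_iff)
    then show "x = y"
    proof cases
      case 1
      then show ?thesis using eq assms(2) by (simp add: \<pi>_def inj_on_eq_iff)
    next
      case 2
      then have "h x = h y" using eq by (simp add: \<pi>_def)
      then show ?thesis using 2 h by (meson bij_betw_imp_inj_on inj_onD)
    next
      case 3
      then show ?thesis using eq by (simp add: \<pi>_def)
    qed
  qed
  then show ?thesis by (intro exI[of _ \<pi>]) (simp add: \<pi>_def)
qed

text \<open>A block of quantifiers over the variables below \<open>j\<close>, needed because the
  number of places of a pattern varies. Above \<open>j\<close> the valuation is unchanged.\<close>

lemma wdef_ex_many:
  assumes "wdef P"
  shows "wdef (\<lambda>w v. \<exists>u. (\<forall>a<j. u a < length w + 2) \<and> (\<forall>a\<ge>j. u a = v a) \<and> P w u)"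
proof (induction j)
  case 0
  have "(\<exists>u. (\<forall>a<0. u a < length w + 2) \<and> (\<forall>a\<ge>0. u a = v a) \<and> P w u) \<longleftrightarrow> P w v"
    for w and v :: "nat \<Rightarrow> nat"
    by (auto simp: fun_eq_iff[symmetric])
  then show ?case using assms by simp
next
  case (Suc j)
  then obtain \<phi> where \<phi>: "\<And>w v. wsat w v \<phi> \<longleftrightarrow>
      (\<exists>u. (\<forall>a<j. u a < length w + 2) \<and> (\<forall>a\<ge>j. u a = v a) \<and> P w u)"
    unfolding wdef_def by blast
  have "wsat w v (WEx j \<phi>) \<longleftrightarrow>
      (\<exists>u. (\<forall>a<Suc j. u a < length w + 2) \<and> (\<forall>a\<ge>Suc j. u a = v a) \<and> P w u)" (is "_ \<longleftrightarrow> ?r")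
    for w v
  proof
    assume "wsat w v (WEx j \<phi>)"
    then obtain a u where "a < length w + 2" and u: "\<forall>a<j. u a < length w + 2" "P w u"
      and eq: "\<forall>b\<ge>j. u b = (v(j := a)) b"
      unfolding wsat.simps \<phi> by blast
    moreover have "u j = a" "\<forall>b\<ge>Suc j. u b = v b" using eq by auto
    ultimately show ?r by (intro exI[of _ u]) (simp add: less_Suc_eq)
  next
    assume ?r
    then obtain u where u: "\<forall>a<Suc j. u a < length w + 2" "\<forall>a\<ge>Suc j. u a = v a" "P w u" by blast
    then have "\<forall>b\<ge>j. u b = (v(j := u j)) b" by (simp add: Suc_le_eq)
    moreover have "\<forall>a<j. u a < length w + 2" using u(1) by simp
    ultimately have "wsat w (v(j := u j)) \<phi>"
      unfolding \<phi> using u(3) by (intro exI[of _ u] conjI)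
    moreover have "u j < length w + 2" using u(1) by simp
    ultimately show "wsat w v (WEx j \<phi>)" unfolding wsat.simps by blast
  qed
  then show ?case unfolding wdef_def by blast
qed

lemma wdef_iff_const: "wdef P \<Longrightarrow> wdef (\<lambda>w v. P w v \<longleftrightarrow> b)"
  using wdef_neg[of P] by (cases b) simp_all

text \<open>A pattern of \<open>k\<close> facts keeps the names of fact \<open>i\<close> in the places \<open>3i\<close>, \<open>3i + 1\<close>, \<open>3i + 2\<close>; the
  facts in \<open>s\<close> are concept facts, for which the third place repeats the second.\<close>

definition pattern_fact :: "nat set \<Rightarrow> (nat \<Rightarrow> name) \<Rightarrow> nat \<Rightarrow> fact" where
  "pattern_fact s \<nu> i = (if i \<in> s then CFact (\<nu> (3 * i)) (\<nu> (3 * i + 1))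
     else RFact (\<nu> (3 * i)) (\<nu> (3 * i + 1)) (\<nu> (3 * i + 2)))"

text \<open>This is the isomorphism type of the tuple of names over the constants \<open>N\<close>,
  in the language of equality.\<close>

definition equality_type :: "name set \<Rightarrow> nat \<Rightarrow> (nat \<Rightarrow> name) \<Rightarrow> (nat \<times> nat) set \<times> (nat \<times> name) set"
  where "equality_type N k \<nu> =
    ({(a, b). a < 3 * k \<and> b < 3 * k \<and> \<nu> a = \<nu> b}, {(a, c). a < 3 * k \<and> c \<in> N \<and> \<nu> a = c})"

definition matches :: "abox \<Rightarrow> nat \<Rightarrow> nat set \<Rightarrow> (nat \<Rightarrow> name) \<Rightarrow> bool" where
  "matches A k s \<nu> \<longleftrightarrow>
     (\<forall>i<k. pattern_fact s \<nu> i \<in> A \<and> (i \<in> s \<longrightarrow> \<nu> (3 * i + 2) = \<nu> (3 * i + 1)))"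

lemma pattern_fact_rename:
  assumes "\<And>a. a < 3 * k \<Longrightarrow> \<pi> (\<nu> a) = \<nu>' a" "i < k"
  shows "rename_fact \<pi> \<pi> \<pi> (pattern_fact s \<nu> i) = pattern_fact s \<nu>' i"
  using assms(2) assms(1)[of "3 * i"] assms(1)[of "3 * i + 1"] assms(1)[of "3 * i + 2"]
  by (simp add: pattern_fact_def)

text \<open>Equal types make the map from \<open>\<nu> a\<close> to \<open>\<nu>' a\<close>, joined
  with the identity on \<open>N\<close>, well defined and injective on a finite set; such a map
  extends to all names.\<close>

lemma equality_type_renaming:
  assumes "finite N" and eq: "equality_type N k \<nu> = equality_type N k \<nu>'"
  obtains \<pi> where "inj \<pi>" "\<And>c. c \<in> N \<Longrightarrow> \<pi> c = c" "\<And>a. a < 3 * k \<Longrightarrow> \<pi> (\<nu> a) = \<nu>' a"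
proof -
  have eq1: "\<nu> a = \<nu> b \<longleftrightarrow> \<nu>' a = \<nu>' b" if "a < 3 * k" "b < 3 * k" for a b
  proof -
    have "(a, b) \<in> fst (equality_type N k \<nu>) \<longleftrightarrow> (a, b) \<in> fst (equality_type N k \<nu>')"
      by (simp only: eq)
    then show ?thesis using that by (simp add: equality_type_def)
  qed
  have eq2: "\<nu> a = c \<longleftrightarrow> \<nu>' a = c" if "a < 3 * k" "c \<in> N" for a c
  proof -
    have "(a, c) \<in> snd (equality_type N k \<nu>) \<longleftrightarrow> (a, c) \<in> snd (equality_type N k \<nu>')"
      by (simp only: eq)
    then show ?thesis using that by (simp add: equality_type_def)
  qed
  let ?X = "N \<union> \<nu> ` {..<3 * k}"
  \<comment> \<open>Several places may hold the name \<open>x\<close>; by equality of the types they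
    all give the same value.\<close>
  define g where "g x = (if x \<in> N then x else \<nu>' (SOME a. a < 3 * k \<and> \<nu> a = x))" for x
  have g\<nu>: "g (\<nu> a) = \<nu>' a" if a: "a < 3 * k" for a
  proof (cases "\<nu> a \<in> N")
    case True
    then show ?thesis using eq2[OF a, of "\<nu> a"] by (simp add: g_def)
  next
    case False
    define b where "b = (SOME b. b < 3 * k \<and> \<nu> b = \<nu> a)"
    have "b < 3 * k \<and> \<nu> b = \<nu> a"
      unfolding b_def by (rule someI[of _ a]) (simp add: a)
    then show ?thesis using False eq1[of b a] a by (simp add: g_def b_def)
  qed
  have gN: "g c = c" if "c \<in> N" for c using that by (simp add: g_def)
  have "inj_on g ?X"
  proof (rule inj_onI)
    fix x y assume "x \<in> ?X" "y \<in> ?X" and g: "g x = g y"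
    then consider "x \<in> N" "y \<in> N" | a where "x \<in> N" "y = \<nu> a" "a < 3 * k"
      | a where "x = \<nu> a" "y \<in> N" "a < 3 * k"
      | a b where "x = \<nu> a" "y = \<nu> b" "a < 3 * k" "b < 3 * k"
      by blast
    then show "x = y"
    proof cases
      case 1
      then show ?thesis using g gN by simp
    next
      case (2 a)
      then show ?thesis using g gN[of x] g\<nu>[of a] eq2[of a x] by auto
    next
      case (3 a)
      then show ?thesis using g gN[of y] g\<nu>[of a] eq2[of a y] by auto
    next
      case (4 a b)
      then show ?thesis using g g\<nu>[of a] g\<nu>[of b] eq1[of a b] by auto
    qed
  qed
  have "finite ?X" using assms(1) by simp
  then obtain \<pi> where \<pi>: "inj \<pi>" "\<forall>x\<in>?X. \<pi> x = g x"
    using inj_on_extend_inj[OF _ \<open>inj_on g ?X\<close>] by blast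
  show thesis
  proof (rule that[OF \<pi>(1)])
    show "\<pi> c = c" if "c \<in> N" for c using \<pi>(2) gN[OF that] that by simp
    show "\<pi> (\<nu> a) = \<nu>' a" if "a < 3 * k" for a using \<pi>(2) g\<nu>[OF that] that by simp
  qed
qed

text \<open>The counterpart of \<open>matches\<close> and \<open>equality_type\<close> on the word:
  \<open>v\<close> holds starting positions in place of names.\<close>

definition pattern_at ::
  "name set \<Rightarrow> nat \<Rightarrow> nat set \<Rightarrow> (nat \<times> nat) set \<times> (nat \<times> name) set \<Rightarrow> bool list \<Rightarrow> (nat \<Rightarrow> nat) \<Rightarrow> bool"
  where "pattern_at N k s \<tau> w v \<longleftrightarrow>
    (\<forall>i\<in>{..<k}. if i \<in> s then cfact_at w (v (3 * i)) (v (3 * i + 1)) \<and> v (3 * i + 2) = v (3 * i + 1)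
       else rfact_at w (v (3 * i)) (v (3 * i + 1)) (v (3 * i + 2))) \<and>
    (\<forall>a\<in>{..<3 * k}. \<forall>b\<in>{..<3 * k}. same_name w (v a) (v b) \<longleftrightarrow> (a, b) \<in> fst \<tau>) \<and>
    (\<forall>a\<in>{..<3 * k}. \<forall>c\<in>N. name_at w c (v a) \<longleftrightarrow> (a, c) \<in> snd \<tau>)"

lemma wdef_pattern_at:
  assumes "finite N"
  shows "wdef (pattern_at N k s \<tau>)"
proof -
  have "wdef (\<lambda>w v. if i \<in> s then cfact_at w (v (3 * i)) (v (3 * i + 1)) \<and> v (3 * i + 2) = v (3 * i + 1)
       else rfact_at w (v (3 * i)) (v (3 * i + 1)) (v (3 * i + 2)))" for i
    by (cases "i \<in> s") (simp_all only: if_True if_False wdef_conj wdef_cfact_at wdef_eq wdef_rfact_at)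
  then show ?thesis
    unfolding pattern_at_def using assms
    by (intro wdef_conj wdef_ball wdef_iff_const wdef_same_name wdef_name_at) simp_all
qed

lemma place_cases:
  fixes a :: nat
  assumes "a < 3 * k"
  obtains i where "i < k" "a = 3 * i \<or> a = 3 * i + 1 \<or> a = 3 * i + 2"
proof
  show "a div 3 < k" using assms by auto
  show "a = 3 * (a div 3) \<or> a = 3 * (a div 3) + 1 \<or> a = 3 * (a div 3) + 2" by presburger
qed

text \<open>Bounding the components of \<open>\<tau>\<close> by the places and by \<open>N\<close>
  makes the pointwise tests equivalent to equality of sets.\<close>

lemma equality_type_at:
  assumes w: "w \<in> abox_words A" and \<nu>: "\<And>a. a < 3 * k \<Longrightarrow> name_at w (\<nu> a) (v a)"
    and \<tau>: "fst \<tau> \<subseteq> {..<3 * k} \<times> {..<3 * k}" "snd \<tau> \<subseteq> {..<3 * k} \<times> N"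
  shows "(\<forall>a\<in>{..<3 * k}. \<forall>b\<in>{..<3 * k}. same_name w (v a) (v b) \<longleftrightarrow> (a, b) \<in> fst \<tau>) \<and>
      (\<forall>a\<in>{..<3 * k}. \<forall>c\<in>N. name_at w c (v a) \<longleftrightarrow> (a, c) \<in> snd \<tau>) \<longleftrightarrow>
    equality_type N k \<nu> = \<tau>"
proof -
  have n: "name_at w c (v a) \<longleftrightarrow> \<nu> a = c" if "a < 3 * k" for a c
    using \<nu>[OF that] name_at_unique[OF w] by metis
  have m: "same_name w (v a) (v b) \<longleftrightarrow> \<nu> a = \<nu> b" if "a < 3 * k" "b < 3 * k" for a b
    using same_name_iff[OF w \<nu>[OF that(1)], of "v b"] n[OF that(2), of "\<nu> a"] by auto
  have 1: "(\<forall>a\<in>{..<3 * k}. \<forall>b\<in>{..<3 * k}. same_name w (v a) (v b) \<longleftrightarrow> (a, b) \<in> fst \<tau>) \<longleftrightarrow>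
      {(a, b). a < 3 * k \<and> b < 3 * k \<and> \<nu> a = \<nu> b} = fst \<tau>"
  proof -
    have "(a, b) \<in> fst \<tau> \<Longrightarrow> a < 3 * k \<and> b < 3 * k" for a b using \<tau>(1) by auto
    then show ?thesis by (simp add: m set_eq_iff) blast
  qed
  have 2: "(\<forall>a\<in>{..<3 * k}. \<forall>c\<in>N. name_at w c (v a) \<longleftrightarrow> (a, c) \<in> snd \<tau>) \<longleftrightarrow>
      {(a, c). a < 3 * k \<and> c \<in> N \<and> \<nu> a = c} = snd \<tau>"
  proof -
    have "(a, c) \<in> snd \<tau> \<Longrightarrow> a < 3 * k \<and> c \<in> N" for a c using \<tau>(2) by auto
    then show ?thesis unfolding set_eq_iff by (auto simp: n)
  qed
  show ?thesis
    unfolding equality_type_def prod_eq_iff fst_conv snd_conv 1 2 ..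
qed

lemma pattern_at_iff:
  assumes w: "w \<in> abox_words A"
    and \<tau>: "fst \<tau> \<subseteq> {..<3 * k} \<times> {..<3 * k}" "snd \<tau> \<subseteq> {..<3 * k} \<times> N"
  shows "(\<exists>v. (\<forall>a<3 * k. v a < length w + 2) \<and> (\<forall>a\<ge>3 * k. v a = 0) \<and> pattern_at N k s \<tau> w v) \<longleftrightarrow>
    (\<exists>\<nu>. matches A k s \<nu> \<and> equality_type N k \<nu> = \<tau>)" (is "?l \<longleftrightarrow> ?r")
proof
  assume ?l
  then obtain v where v: "pattern_at N k s \<tau> w v" by blast
  define \<nu> where "\<nu> a = (SOME c. name_at w c (v a))" for a
  have \<nu>I: "\<nu> a = c" if "name_at w c (v a)" for a c
    unfolding \<nu>_def using that name_at_unique[OF w] by blast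
  have i: "pattern_fact s \<nu> i \<in> A \<and> (i \<in> s \<longrightarrow> \<nu> (3 * i + 2) = \<nu> (3 * i + 1)) \<and>
      name_at w (\<nu> (3 * i)) (v (3 * i)) \<and> name_at w (\<nu> (3 * i + 1)) (v (3 * i + 1)) \<and>
      name_at w (\<nu> (3 * i + 2)) (v (3 * i + 2))" if "i < k" for i
  proof (cases "i \<in> s")
    case True
    then have c: "cfact_at w (v (3 * i)) (v (3 * i + 1))" and e: "v (3 * i + 2) = v (3 * i + 1)"
      using v that unfolding pattern_at_def by (metis lessThan_iff)+
    obtain B a where "CFact B a \<in> A" "name_at w B (v (3 * i))" "name_at w a (v (3 * i + 1))"
      using cfact_atD[OF w c] by blast
    moreover have "name_at w a (v (3 * i + 2))" using calculation e by simp
    ultimately show ?thesis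
      using \<nu>I[of B "3 * i"] \<nu>I[of a "3 * i + 1"] \<nu>I[of a "3 * i + 2"] True
      by (simp add: pattern_fact_def)
  next
    case False
    then have c: "rfact_at w (v (3 * i)) (v (3 * i + 1)) (v (3 * i + 2))"
      using v that unfolding pattern_at_def by (metis lessThan_iff)
    obtain r a b where "RFact r a b \<in> A" "name_at w r (v (3 * i))" "name_at w a (v (3 * i + 1))"
      "name_at w b (v (3 * i + 2))"
      using rfact_atD[OF w c] by blast
    then show ?thesis
      using \<nu>I[of r "3 * i"] \<nu>I[of a "3 * i + 1"] \<nu>I[of b "3 * i + 2"] False
      by (simp add: pattern_fact_def)
  qed
  have "name_at w (\<nu> a) (v a)" if "a < 3 * k" for a
    using that i by (elim place_cases) blast
  then have "equality_type N k \<nu> = \<tau>"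
    using equality_type_at[OF w _ \<tau>] v unfolding pattern_at_def by blast
  then show ?r using i unfolding matches_def by blast
next
  assume ?r
  then obtain \<nu> where m: "matches A k s \<nu>" and eq: "equality_type N k \<nu> = \<tau>" by blast
  have "\<exists>x y z. (if i \<in> s then cfact_at w x y \<and> z = y else rfact_at w x y z) \<and>
      name_at w (\<nu> (3 * i)) x \<and> name_at w (\<nu> (3 * i + 1)) y \<and> name_at w (\<nu> (3 * i + 2)) z"
    if "i < k" for i
  proof (cases "i \<in> s")
    case True
    then have "CFact (\<nu> (3 * i)) (\<nu> (3 * i + 1)) \<in> A" "\<nu> (3 * i + 2) = \<nu> (3 * i + 1)"
      using m that unfolding matches_def pattern_fact_def by auto
    then show ?thesis using cfact_atI[OF w] True by metis
  next
    case False
    then have "RFact (\<nu> (3 * i)) (\<nu> (3 * i + 1)) (\<nu> (3 * i + 2)) \<in> A"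
      using m that unfolding matches_def pattern_fact_def by auto
    then show ?thesis using rfact_atI[OF w] False by metis
  qed
  then obtain x y z where xyz: "\<And>i. i < k \<Longrightarrow>
      (if i \<in> s then cfact_at w (x i) (y i) \<and> z i = y i else rfact_at w (x i) (y i) (z i)) \<and>
      name_at w (\<nu> (3 * i)) (x i) \<and> name_at w (\<nu> (3 * i + 1)) (y i) \<and>
      name_at w (\<nu> (3 * i + 2)) (z i)"
    by metis
  \<comment> \<open>The three position functions are interleaved. Outside the places
    \<open>v\<close> is 0, the value that the evaluation of the closed formula starts with.\<close>
  define v where "v a = (if a < 3 * k then
      if a mod 3 = 0 then x (a div 3) else if a mod 3 = 1 then y (a div 3) else z (a div 3) else 0)" for a
  have v: "v (3 * i) = x i" "v (3 * i + 1) = y i" "v (3 * i + 2) = z i" if "i < k" for i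
  proof -
    have "(3 * i + 1) div 3 = i" "(3 * i + 1) mod 3 = 1" "(3 * i + 2) div 3 = i" "(3 * i + 2) mod 3 = 2"
      by presburger+
    then show "v (3 * i) = x i" "v (3 * i + 1) = y i" "v (3 * i + 2) = z i"
      using that by (simp_all add: v_def del: One_nat_def add_2_eq_Suc')
  qed
  have n: "name_at w (\<nu> a) (v a)" if "a < 3 * k" for a
    using that
  proof (rule place_cases)
    fix i assume "i < k" "a = 3 * i \<or> a = 3 * i + 1 \<or> a = 3 * i + 2"
    then show ?thesis using xyz[of i] v[of i] by metis
  qed
  have "pattern_at N k s \<tau> w v"
    unfolding pattern_at_def
  proof (rule conjI)
    show "\<forall>i\<in>{..<k}. if i \<in> s then cfact_at w (v (3 * i)) (v (3 * i + 1)) \<and> v (3 * i + 2) = v (3 * i + 1)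
       else rfact_at w (v (3 * i)) (v (3 * i + 1)) (v (3 * i + 2))"
      using xyz v by (metis lessThan_iff)
  qed (rule iffD2[OF equality_type_at[OF w n \<tau>] eq])
  moreover have "\<forall>a<3 * k. v a < length w + 2" using n name_at_bound by blast
  moreover have "\<forall>a\<ge>3 * k. v a = 0" by (simp add: v_def)
  ultimately show ?l by blast
qed

text \<open>Locality bounds the number of facts to search for, invariance makes membership of these
  facts a matter of their pattern, and monotonicity lifts a pattern found inside \<open>A\<close> to
  \<open>A\<close> itself.\<close>

theorem local_invariant_in_AC0:
  fixes Q :: "abox \<Rightarrow> bool"
  assumes "finite N"
    and mono: "\<And>A B. A \<subseteq> B \<Longrightarrow> Q A \<Longrightarrow> Q B"
    and local: "\<And>A. Q A \<Longrightarrow> \<exists>B\<subseteq>A. finite B \<and> card B \<le> K \<and> Q B"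
    and invariant: "\<And>\<pi> A. inj \<pi> \<Longrightarrow> \<forall>c\<in>N. \<pi> c = c \<Longrightarrow> Q A \<Longrightarrow> Q (rename_fact \<pi> \<pi> \<pi> ` A)"
  shows "in_AC0 abox_words P {A. Q A}"
proof -
  \<comment> \<open>These finitely many types are hard-wired into the formula; \<open>Q\<close> is
    never evaluated on the input.\<close>
  define good where "good k s = {equality_type N k \<nu> | \<nu>. Q (pattern_fact s \<nu> ` {..<k})}" for k s
  have good_sub: "good k s \<subseteq> Pow ({..<3 * k} \<times> {..<3 * k}) \<times> Pow ({..<3 * k} \<times> N)" for k s
    by (auto simp: good_def equality_type_def)
  have good_fin: "finite (good k s)" for k s
    by (rule finite_subset[OF good_sub]) (simp add: assms(1))
  have Q_iff: "Q A \<longleftrightarrow> (\<exists>k\<in>{..K}. \<exists>s\<in>Pow {..<k}. \<exists>\<tau>\<in>good k s. \<exists>\<nu>. matches A k s \<nu> \<and> equality_type N k \<nu> = \<tau>)"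
    (is "_ \<longleftrightarrow> ?r") for A
  proof
    assume "Q A"
    then obtain B where B: "B \<subseteq> A" "finite B" "card B \<le> K" "Q B" using local by blast
    obtain f where f: "bij_betw f {0..<card B} B" using ex_bij_betw_nat_finite[OF B(2)] by blast
    let ?k = "card B"
    define s where "s = {i \<in> {..<?k}. \<exists>D a. f i = CFact D a}"
    \<comment> \<open>Place \<open>j\<close> belongs to fact \<open>j div 3\<close>. For a concept
      fact the remainders 1 and 2 both give the individual.\<close>
    define \<nu> where "\<nu> j = (case f (j div 3) of
        CFact D a \<Rightarrow> if j mod 3 = 0 then D else a
      | RFact r a b \<Rightarrow> if j mod 3 = 0 then r else if j mod 3 = 1 then a else b)" for j
    have i: "pattern_fact s \<nu> i = f i \<and> (i \<in> s \<longrightarrow> \<nu> (3 * i + 2) = \<nu> (3 * i + 1))" if "i < ?k" for i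
    proof -
      have "(3 * i + 1) div 3 = i" "(3 * i + 1) mod 3 = 1" "(3 * i + 2) div 3 = i" "(3 * i + 2) mod 3 = 2"
        by presburger+
      then show ?thesis
        using that by (cases "f i") (simp_all add: pattern_fact_def s_def \<nu>_def del: One_nat_def add_2_eq_Suc')
    qed
    have "f ` {..<?k} = B" using f by (auto simp: bij_betw_def atLeast0LessThan)
    then have im: "pattern_fact s \<nu> ` {..<?k} = B" using i by (metis (no_types, lifting) image_cong lessThan_iff)
    then have "matches A ?k s \<nu>" using B(1) i unfolding matches_def by auto
    moreover have "equality_type N ?k \<nu> \<in> good ?k s" using im B(4) unfolding good_def by auto
    moreover have "s \<in> Pow {..<?k}" by (auto simp: s_def)
    ultimately show ?r using B(3) by blast
  next
    assume ?r
    then obtain k s \<nu> \<nu>' where m: "matches A k s \<nu>'" and eq: "equality_type N k \<nu> = equality_type N k \<nu>'"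
      and Q: "Q (pattern_fact s \<nu> ` {..<k})"
      unfolding good_def by force
    \<comment> \<open>\<open>\<nu>\<close> witnesses that the type is good and \<open>\<nu>'\<close>
      is the match in \<open>A\<close>; the renaming carries the facts of the former to those of the
      latter.\<close>
    obtain \<pi> where "inj \<pi>" "\<And>c. c \<in> N \<Longrightarrow> \<pi> c = c" and \<pi>: "\<And>a. a < 3 * k \<Longrightarrow> \<pi> (\<nu> a) = \<nu>' a"
      using equality_type_renaming[OF assms(1) eq] by blast
    then have "Q (rename_fact \<pi> \<pi> \<pi> ` pattern_fact s \<nu> ` {..<k})" using invariant Q by blast
    moreover have "rename_fact \<pi> \<pi> \<pi> ` pattern_fact s \<nu> ` {..<k} \<subseteq> A"
      using pattern_fact_rename[of k \<pi>, OF \<pi>] m unfolding matches_def by auto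
    ultimately show "Q A" using mono by blast
  qed
  have "wdef (\<lambda>w v. \<exists>k\<in>{..K}. \<exists>s\<in>Pow {..<k}. \<exists>\<tau>\<in>good k s. \<exists>u.
      (\<forall>a<3 * k. u a < length w + 2) \<and> (\<forall>a\<ge>3 * k. u a = v a) \<and> pattern_at N k s \<tau> w u)"
    by (intro wdef_bex wdef_ex_many wdef_pattern_at good_fin assms(1) finite_atMost finite_Pow_iff[THEN iffD2] finite_lessThan)
  then obtain \<phi> where \<phi>: "\<And>w v. wsat w v \<phi> \<longleftrightarrow> (\<exists>k\<in>{..K}. \<exists>s\<in>Pow {..<k}. \<exists>\<tau>\<in>good k s. \<exists>u.
      (\<forall>a<3 * k. u a < length w + 2) \<and> (\<forall>a\<ge>3 * k. u a = v a) \<and> pattern_at N k s \<tau> w u)"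
    unfolding wdef_def by blast
  show ?thesis
  proof (rule in_AC0_if_wform)
    fix A w assume w: "w \<in> abox_words A"
    have "(\<exists>u. (\<forall>a<3 * k. u a < length w + 2) \<and> (\<forall>a\<ge>3 * k. u a = 0) \<and> pattern_at N k s \<tau> w u) \<longleftrightarrow>
        (\<exists>\<nu>. matches A k s \<nu> \<and> equality_type N k \<nu> = \<tau>)" if "\<tau> \<in> good k s" for k s \<tau>
      using subsetD[OF good_sub that] by (intro pattern_at_iff[OF w]) auto
    then show "wsat w (\<lambda>_. 0) \<phi> \<longleftrightarrow> A \<in> {A. Q A}"
      unfolding \<phi> mem_Collect_eq Q_iff by (intro bex_cong refl)
  qed
qed


section \<open>Renaming proofs\<close>

text \<open>A function symbol is an axiom only as a label: the names inside it are left alone, and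
  \<open>trm_names\<close> ignores them accordingly.\<close>

primrec rename_trm :: "(name \<Rightarrow> name) \<Rightarrow> trm \<Rightarrow> trm" where
  "rename_trm \<pi> (Var x) = Var x"
| "rename_trm \<pi> (Const a) = Const (\<pi> a)"
| "rename_trm \<pi> (Fun f t) = Fun f (rename_trm \<pi> t)"

primrec rename_atom ::
  "(name \<Rightarrow> name) \<Rightarrow> (name \<Rightarrow> name) \<Rightarrow> (name \<Rightarrow> name) \<Rightarrow> atom \<Rightarrow> atom" where
  "rename_atom \<gamma> \<rho> \<pi> (CAtom A t) = CAtom (\<gamma> A) (rename_trm \<pi> t)"
| "rename_atom \<gamma> \<rho> \<pi> (RAtom r s t) = RAtom (\<rho> r) (rename_trm \<pi> s) (rename_trm \<pi> t)"
| "rename_atom \<gamma> \<rho> \<pi> (EqAtom s t) = EqAtom (rename_trm \<pi> s) (rename_trm \<pi> t)"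

primrec rename_sentence ::
  "(name \<Rightarrow> name) \<Rightarrow> (name \<Rightarrow> name) \<Rightarrow> (name \<Rightarrow> name) \<Rightarrow> sentence \<Rightarrow> sentence" where
  "rename_sentence \<gamma> \<rho> \<pi> (Clause B H) =
     Clause (map (rename_atom \<gamma> \<rho> \<pi>) B) (map (rename_atom \<gamma> \<rho> \<pi>) H)"
| "rename_sentence \<gamma> \<rho> \<pi> (CQ as) = CQ (map (rename_atom \<gamma> \<rho> \<pi>) as)"

primrec trm_names :: "trm \<Rightarrow> name set" where
  "trm_names (Var x) = {}"
| "trm_names (Const a) = {a}"
| "trm_names (Fun f t) = trm_names t"

primrec atom_names :: "atom \<Rightarrow> name set" where
  "atom_names (CAtom A t) = insert A (trm_names t)"
| "atom_names (RAtom r s t) = insert r (trm_names s \<union> trm_names t)"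
| "atom_names (EqAtom s t) = trm_names s \<union> trm_names t"

definition sentence_names :: "sentence \<Rightarrow> name set" where
  "sentence_names \<phi> = (\<Union>\<alpha>\<in>sentence_atoms \<phi>. atom_names \<alpha>)"

lemma finite_sentence_names: "finite (sentence_names \<phi>)"
proof -
  have "finite (trm_names t)" for t by (induction t) auto
  then have "finite (atom_names \<alpha>)" for \<alpha> by (cases \<alpha>) auto
  then show ?thesis by (cases \<phi>) (auto simp: sentence_names_def)
qed

lemma rename_trm_fixed: "\<forall>c\<in>trm_names t. \<pi> c = c \<Longrightarrow> rename_trm \<pi> t = t"
  by (induction t) auto

lemma rename_atom_fixed:
  "\<forall>c\<in>atom_names \<alpha>. \<gamma> c = c \<and> \<rho> c = c \<and> \<pi> c = c \<Longrightarrow> rename_atom \<gamma> \<rho> \<pi> \<alpha> = \<alpha>"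
  by (cases \<alpha>) (auto simp: rename_trm_fixed)

lemma rename_sentence_fixed:
  "\<forall>c\<in>sentence_names \<phi>. \<gamma> c = c \<and> \<rho> c = c \<and> \<pi> c = c \<Longrightarrow> rename_sentence \<gamma> \<rho> \<pi> \<phi> = \<phi>"
  by (cases \<phi>) (auto simp: sentence_names_def intro!: map_idI rename_atom_fixed)

lemma rename_trm_subst:
  "rename_trm \<pi> (subst_term \<sigma> t) = subst_term (\<lambda>x. rename_trm \<pi> (\<sigma> x)) (rename_trm \<pi> t)"
  by (induction t) auto

lemma rename_atom_subst:
  "rename_atom \<gamma> \<rho> \<pi> (subst_atom \<sigma> \<alpha>) =
    subst_atom (\<lambda>x. rename_trm \<pi> (\<sigma> x)) (rename_atom \<gamma> \<rho> \<pi> \<alpha>)"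
  by (cases \<alpha>) (auto simp: rename_trm_subst)

lemma rename_trm_inject: "inj \<pi> \<Longrightarrow> rename_trm \<pi> s = rename_trm \<pi> t \<longleftrightarrow> s = t"
proof (induction s arbitrary: t)
  case (Var x) then show ?case by (cases t) auto
next
  case (Const a) then show ?case by (cases t) (auto dest: injD)
next
  case (Fun f s) then show ?case by (cases t) auto
qed

text \<open>\<open>replace_term\<close> branches on equality of terms, and this is where injectivity
  enters.\<close>

lemma rename_trm_replace:
  assumes "inj \<pi>"
  shows "rename_trm \<pi> (replace_term s t u) =
    replace_term (rename_trm \<pi> s) (rename_trm \<pi> t) (rename_trm \<pi> u)"
proof (induction u)
  case (Fun f u)
  then show ?case using rename_trm_inject[OF assms, of "Fun f u" s] by simp
next
  case (Var x)
  then show ?case using rename_trm_inject[OF assms, of "Var x" s] by simp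
next
  case (Const a)
  then show ?case using rename_trm_inject[OF assms, of "Const a" s] by simp
qed

lemma rename_atom_replace:
  assumes "inj \<pi>"
  shows "rename_atom \<gamma> \<rho> \<pi> (map_atom_terms (replace_term s t) \<alpha>) =
    map_atom_terms (replace_term (rename_trm \<pi> s) (rename_trm \<pi> t)) (rename_atom \<gamma> \<rho> \<pi> \<alpha>)"
  by (cases \<alpha>) (simp_all add: rename_trm_replace[OF assms])

lemma ground_term_rename [simp]: "ground_term T (rename_trm \<pi> t) \<longleftrightarrow> ground_term T t"
  by (induction t) auto

lemma ground_atom_rename [simp]: "ground_atom T (rename_atom \<gamma> \<rho> \<pi> \<alpha>) \<longleftrightarrow> ground_atom T \<alpha>"
  by (cases \<alpha>) (auto simp: ground_atom_def)

lemma fact_sentence_rename: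
  "fact_sentence (rename_fact \<gamma> \<rho> \<pi> f) = rename_sentence \<gamma> \<rho> \<pi> (fact_sentence f)"
  by (cases f) auto

text \<open>A model of the renamed sentences is turned into a model of the original ones by reading each
  name as its image, so the maps need not be injective here.\<close>

lemma entails_rename:
  assumes "entails \<Gamma> \<phi>"
  shows "entails (rename_sentence \<gamma> \<rho> \<pi> ` \<Gamma>) (rename_sentence \<gamma> \<rho> \<pi> \<phi>)"
  unfolding entails_def
proof (intro allI impI)
  fix I :: "nat interp"
  assume I: "is_interp I" and \<Gamma>: "\<forall>\<psi>\<in>rename_sentence \<gamma> \<rho> \<pi> ` \<Gamma>. sat I \<psi>"
  define J where "J = I\<lparr>cint := \<lambda>A. cint I (\<gamma> A), rint := \<lambda>r. rint I (\<rho> r),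
      iint := \<lambda>a. iint I (\<pi> a)\<rparr>"
  have "term_val I v (rename_trm \<pi> t) = term_val J v t" for v t
    by (induction t) (simp_all add: J_def)
  then have "sat_atom I v (rename_atom \<gamma> \<rho> \<pi> \<alpha>) = sat_atom J v \<alpha>" for v \<alpha>
    by (cases \<alpha>) (simp_all, simp_all add: J_def)
  then have sat: "sat I (rename_sentence \<gamma> \<rho> \<pi> \<psi>) = sat J \<psi>" for \<psi>
    by (cases \<psi>) (simp_all, simp_all add: J_def)
  have "is_interp J" using I by (auto simp: is_interp_def J_def)
  then show "sat I (rename_sentence \<gamma> \<rho> \<pi> \<phi>)"
    using assms \<Gamma> sat unfolding entails_def by auto
qed

text \<open>In (MP) and (G) the rule and the query stay fixed and the renaming is absorbed into the
  substitution; (C) only lists atoms, and (E) uses injectivity on individuals.\<close>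

lemma sk_inferences_rename:
  assumes inf: "(S, d) \<in> sk_inferences T q" and "inj \<pi>"
    and T: "\<forall>\<phi>\<in>skolem ` T. rename_sentence \<gamma> \<rho> \<pi> \<phi> = \<phi>"
    and q: "rename_sentence \<gamma> \<rho> \<pi> (CQ q) = CQ q"
  shows "(rename_sentence \<gamma> \<rho> \<pi> ` S, rename_sentence \<gamma> \<rho> \<pi> d) \<in> sk_inferences T q"
  using inf
proof cases
  case (MP B H \<sigma> \<beta>)
  let ?\<sigma> = "\<lambda>x. rename_trm \<pi> (\<sigma> x)"
  have maps: "map (rename_atom \<gamma> \<rho> \<pi>) B = B" "map (rename_atom \<gamma> \<rho> \<pi>) H = H"
    using bspec[OF T MP(3)] by simp_all
  then have fixed: "rename_atom \<gamma> \<rho> \<pi> \<alpha> = \<alpha>" if "\<alpha> \<in> set B \<union> set H" for \<alpha>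
    using that by (auto simp: map_idI map_eq_conv[of _ _ id, simplified])
  have "rename_atom \<gamma> \<rho> \<pi> \<beta> \<in> subst_atom ?\<sigma> ` set H"
    using MP(5) fixed by (auto simp: rename_atom_subst)
  from sk_inferences.MP[OF MP(3), of ?\<sigma>, OF _ this]
  have "(insert (Clause B H) ((\<lambda>\<alpha>. CQ [subst_atom ?\<sigma> \<alpha>]) ` set B), CQ [rename_atom \<gamma> \<rho> \<pi> \<beta>])
      \<in> sk_inferences T q" using MP(4) by simp
  moreover have "rename_sentence \<gamma> \<rho> \<pi> ` S =
      insert (Clause B H) ((\<lambda>\<alpha>. CQ [subst_atom ?\<sigma> \<alpha>]) ` set B)"
    using fixed unfolding MP(1) by (simp add: image_image rename_atom_subst maps)
  ultimately show ?thesis by (simp add: MP(2))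
next
  case (E \<alpha> s t)
  then show ?thesis
    using sk_inferences.E[of T "rename_atom \<gamma> \<rho> \<pi> \<alpha>" "rename_trm \<pi> s" "rename_trm \<pi> t" q]
    by (simp add: rename_atom_replace[OF assms(2)])
next
  case (C as)
  then show ?thesis
    using sk_inferences.C[of "map (rename_atom \<gamma> \<rho> \<pi>) as" T q] by (simp add: image_image)
next
  case (G as \<sigma>)
  let ?\<sigma> = "\<lambda>x. rename_trm \<pi> (\<sigma> x)"
  have "rename_atom \<gamma> \<rho> \<pi> \<alpha> = \<alpha>" if "\<alpha> \<in> set q" for \<alpha>
    using that q by (auto simp: map_eq_conv[of _ _ id, simplified])
  then have "subst_atom ?\<sigma> ` set q = rename_atom \<gamma> \<rho> \<pi> ` subst_atom \<sigma> ` set q"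
    by (simp add: image_image rename_atom_subst)
  then have "subst_atom ?\<sigma> ` set q \<subseteq> set (map (rename_atom \<gamma> \<rho> \<pi>) as)"
    using G by auto
  then show ?thesis
    using sk_inferences.G[of "map (rename_atom \<gamma> \<rho> \<pi>) as" T ?\<sigma> q] G q by simp
qed

section \<open>Renaming whole proofs\<close>

definition rename_proof :: "(name \<Rightarrow> name) \<Rightarrow> (name \<Rightarrow> name) \<Rightarrow> (name \<Rightarrow> name) \<Rightarrow>
    ('v, sentence) dstruct \<Rightarrow> ('v, sentence) dstruct" where
  "rename_proof \<gamma> \<rho> \<pi> p = p\<lparr>lab := \<lambda>v. rename_sentence \<gamma> \<rho> \<pi> (lab p v)\<rparr>"

lemma rename_proof_simps [simp]:
  "verts (rename_proof \<gamma> \<rho> \<pi> p) = verts p"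
  "infs (rename_proof \<gamma> \<rho> \<pi> p) = infs p"
  "lab (rename_proof \<gamma> \<rho> \<pi> p) v = rename_sentence \<gamma> \<rho> \<pi> (lab p v)"
  by (simp_all add: rename_proof_def)

lemma rename_proof_structure [simp]:
  "leaf (rename_proof \<gamma> \<rho> \<pi> p) = leaf p"
  "sink (rename_proof \<gamma> \<rho> \<pi> p) = sink p"
  "step_rel (rename_proof \<gamma> \<rho> \<pi> p) = step_rel p"
  by (auto simp: leaf_def sink_def step_rel_def)

lemma size_measure_rename [simp]: "size_measure (rename_proof \<gamma> \<rho> \<pi> p) = size_measure p"
  by (simp add: size_measure_def)

lemma tree_measure_rename [simp]: "tree_measure (rename_proof \<gamma> \<rho> \<pi> p) = tree_measure p"
  by (simp add: tree_measure_def vertex_tree_size_def)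

text \<open>The condition on \<open>B\<close> concerns only facts that label a vertex. This lets one
  lemma cover larger ABoxes, restriction to the facts in use, and merging of names.\<close>

lemma sk_proof_rename:
  assumes p: "sk_proof T A q p" and "inj \<pi>"
    and T: "\<forall>\<phi>\<in>skolem ` T. rename_sentence \<gamma> \<rho> \<pi> \<phi> = \<phi>"
    and q: "rename_sentence \<gamma> \<rho> \<pi> (CQ q) = CQ q"
    and B: "\<And>f. f \<in> A \<Longrightarrow> fact_sentence f \<in> lab p ` verts p \<Longrightarrow> rename_fact \<gamma> \<rho> \<pi> f \<in> B"
  shows "sk_proof T B q (rename_proof \<gamma> \<rho> \<pi> p)"
proof -
  let ?r = "rename_sentence \<gamma> \<rho> \<pi>"
  have im: "lab (rename_proof \<gamma> \<rho> \<pi> p) ` S = ?r ` lab p ` S" for S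
    by (simp add: image_image)
  have leaf: "?r (lab p v) \<in> skolem_theory T B" if "leaf p v" for v
  proof -
    have "lab p v \<in> skolem_theory T A"
      using p that by (simp add: sk_proof_def proof_of_def derivation_structure_def)
    then consider "lab p v \<in> skolem ` T" | f where "f \<in> A" "lab p v = fact_sentence f"
      by (auto simp: skolem_theory_def)
    then show ?thesis
    proof cases
      case 1
      then show ?thesis using T by (auto simp: skolem_theory_def)
    next
      case (2 f)
      moreover have "v \<in> verts p" using that by (simp add: leaf_def)
      ultimately have "rename_fact \<gamma> \<rho> \<pi> f \<in> B"
        using B[of f] by (metis imageI)
      then show ?thesis using 2 by (auto simp: skolem_theory_def fact_sentence_rename[symmetric])
    qed
  qed
  have "derivation_structure (skolem_theory T A) p"
    using p by (simp add: sk_proof_def proof_of_def)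
  then have "derivation_structure (skolem_theory T B) (rename_proof \<gamma> \<rho> \<pi> p)"
    unfolding derivation_structure_def im rename_proof_simps rename_proof_structure
    using leaf entails_rename by fast
  moreover have "\<forall>(S, d)\<in>infs p. (lab (rename_proof \<gamma> \<rho> \<pi> p) ` S,
      lab (rename_proof \<gamma> \<rho> \<pi> p) d) \<in> sk_inferences T q"
    using p sk_inferences_rename[OF _ \<open>inj \<pi>\<close> T q]
    unfolding im rename_proof_simps sk_proof_def by fast
  ultimately show ?thesis
    using p q unfolding sk_proof_def proof_of_def by simp
qed

lemma sk_proof_facts:
  assumes "sk_proof T A q p" "{f \<in> A. fact_sentence f \<in> lab p ` verts p} \<subseteq> B"
  shows "sk_proof T B q p"
proof -
  have "rename_sentence id id id \<phi> = \<phi>" for \<phi> by (rule rename_sentence_fixed) simp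
  moreover have "rename_fact id id id f = f" for f by (cases f) simp_all
  moreover have "rename_proof id id id p = p" using calculation(1) by (simp add: rename_proof_def)
  ultimately show ?thesis
    using sk_proof_rename[OF assms(1), of id id id B] assms(2) by (auto simp del: rename_sentence.simps)
qed

section \<open>Measures of proofs\<close>

lemma finite_subterms: "finite (subterms t)"
  by (induction t) auto

lemma finite_ground_terms_in: "finite (ground_terms_in \<phi>)"
proof -
  have "finite (\<Union>\<alpha>\<in>sentence_atoms \<phi>. \<Union>u\<in>atom_terms \<alpha>. subterms u)"
  proof (intro finite_UN_I finite_subterms)
    show "finite (sentence_atoms \<phi>)" by (cases \<phi>) auto
    show "finite (atom_terms \<alpha>)" for \<alpha> by (cases \<alpha>) auto
  qed
  then show ?thesis by (rule rev_finite_subset) (auto simp: ground_terms_in_def)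
qed

lemma ground_terms_in_rename:
  "ground_terms_in (rename_sentence \<gamma> \<rho> \<pi> \<phi>) = rename_trm \<pi> ` ground_terms_in \<phi>"
proof -
  have 1: "sentence_atoms (rename_sentence \<gamma> \<rho> \<pi> \<phi>) = rename_atom \<gamma> \<rho> \<pi> ` sentence_atoms \<phi>"
    by (cases \<phi>) auto
  have 2: "atom_terms (rename_atom \<gamma> \<rho> \<pi> \<alpha>) = rename_trm \<pi> ` atom_terms \<alpha>" for \<alpha>
    by (cases \<alpha>) auto
  have 3: "subterms (rename_trm \<pi> t) = rename_trm \<pi> ` subterms t" for t
    by (induction t) auto
  have 4: "term_vars (rename_trm \<pi> t) = term_vars t" for t
    by (induction t) auto
  show ?thesis
    unfolding ground_terms_in_def 1 bex_simps 2 3 by (auto simp: 4 intro!: imageI)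
qed

text \<open>Distinct terms may collapse under the renaming, so only an inequality holds; it has the
  direction that an upper bound needs.\<close>

lemma domain_measure_rename:
  assumes "finite (verts p)"
  shows "domain_measure (rename_proof \<gamma> \<rho> \<pi> p) \<le> domain_measure p"
proof -
  have "(\<Union>v\<in>verts p. ground_terms_in (rename_sentence \<gamma> \<rho> \<pi> (lab p v))) =
      rename_trm \<pi> ` (\<Union>v\<in>verts p. ground_terms_in (lab p v))"
    by (auto simp: ground_terms_in_rename)
  then show ?thesis
    unfolding domain_measure_def using assms finite_ground_terms_in by (simp add: card_image_le)
qed

text \<open>The unravelling at a vertex contains each of its ancestors at least once, and in a
  finite acyclic structure with a single sink every vertex is an ancestor of the sink.\<close>

lemma card_verts_le_tree_measure:
  assumes p: "proof_of U \<eta> p"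
  shows "card (verts p) \<le> tree_measure p"
proof -
  have fin: "finite (verts p)" and ac: "acyclic (step_rel p)" and ex1: "\<exists>!v. sink p v"
    and uniq: "\<And>d S S'. (S, d) \<in> infs p \<Longrightarrow> (S', d) \<in> infs p \<Longrightarrow> S = S'"
    and inf: "\<And>S d. (S, d) \<in> infs p \<Longrightarrow> S \<subseteq> verts p \<and> finite S \<and> d \<in> verts p"
    using p by (auto simp: proof_of_def derivation_structure_def)
  have "step_rel p \<subseteq> verts p \<times> verts p" using inf by (fastforce simp: step_rel_def)
  then have finr: "finite (step_rel p)" using fin finite_subset by blast
  let ?anc = "\<lambda>v. {u. (u, v) \<in> (step_rel p)\<^sup>*}"
  have le: "finite (?anc v) \<and> card (?anc v) \<le> vertex_tree_size p v" if "v \<in> verts p" for v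
    using finite_acyclic_wf[OF finr ac] that
  proof (induction v rule: wf_induct_rule)
    case (less v)
    show ?case
    proof (cases "leaf p v")
      case True
      then have "?anc v = {v}" by (auto simp: leaf_def step_rel_def elim: rtranclE)
      then show ?thesis using vertex_tree_size_rec(1)[OF p True] by simp
    next
      case False
      then obtain S where S: "(S, v) \<in> infs p" using less.prems by (auto simp: leaf_def)
      have pre: "(s, v) \<in> step_rel p \<longleftrightarrow> s \<in> S" for s
      proof
        assume "(s, v) \<in> step_rel p"
        then obtain S' where S': "(S', v) \<in> infs p" "s \<in> S'" unfolding step_rel_def by blast
        then show "s \<in> S" using uniq[OF S S'(1)] by simp
      next
        assume "s \<in> S"
        then show "(s, v) \<in> step_rel p" using S unfolding step_rel_def by blast
      qed
      have IH: "finite (?anc s) \<and> card (?anc s) \<le> vertex_tree_size p s" if "s \<in> S" for s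
        using that less.IH[of s] pre inf[OF S] by auto
      have "(u, v) \<in> (step_rel p)\<^sup>* \<longleftrightarrow> u = v \<or> (\<exists>s\<in>S. (u, s) \<in> (step_rel p)\<^sup>*)" for u
      proof
        assume "(u, v) \<in> (step_rel p)\<^sup>*"
        then show "u = v \<or> (\<exists>s\<in>S. (u, s) \<in> (step_rel p)\<^sup>*)"
          by (cases rule: rtranclE) (use pre in auto)
      next
        assume "u = v \<or> (\<exists>s\<in>S. (u, s) \<in> (step_rel p)\<^sup>*)"
        then show "(u, v) \<in> (step_rel p)\<^sup>*"
          using pre by (auto intro: rtrancl_into_rtrancl)
      qed
      then have eq: "?anc v = insert v (\<Union>s\<in>S. ?anc s)" by auto
      have finS: "finite S" using inf[OF S] by simp
      have "card (?anc v) \<le> Suc (card (\<Union>s\<in>S. ?anc s))"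
        unfolding eq by (rule card_insert_le_m1[of "Suc _", simplified]) simp
      also have "card (\<Union>s\<in>S. ?anc s) \<le> (\<Sum>s\<in>S. card (?anc s))" by (rule card_UN_le[OF finS])
      also have "\<dots> \<le> (\<Sum>s\<in>S. vertex_tree_size p s)" using IH by (intro sum_mono) simp
      finally have "card (?anc v) \<le> vertex_tree_size p v"
        using vertex_tree_size_rec(2)[OF p S] by simp
      moreover have "finite (?anc v)" unfolding eq using finS IH by simp
      ultimately show ?thesis by simp
    qed
  qed
  obtain t where t: "sink p t" and t_unique: "\<And>v. sink p v \<Longrightarrow> v = t" using ex1 by blast
  \<comment> \<open>Induction along the reversed edges: a vertex that is not the sink is a premise
    of some inference, whose conclusion already reaches \<open>t\<close>.\<close>
  have "u \<in> ?anc t" if "u \<in> verts p" for u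
    using finite_acyclic_wf_converse[OF finr ac] that
  proof (induction u rule: wf_induct_rule)
    case (less u)
    show ?case
    proof (cases "sink p u")
      case True
      then show ?thesis using t_unique by auto
    next
      case False
      then obtain S d where S: "(S, d) \<in> infs p" "u \<in> S" using less.prems by (auto simp: sink_def)
      then have "(u, d) \<in> step_rel p" by (auto simp: step_rel_def)
      moreover have "d \<in> ?anc t" using less.IH[of d] calculation inf[OF S(1)] by auto
      ultimately show ?thesis by (auto intro: converse_rtrancl_into_rtrancl)
    qed
  qed
  then have "verts p \<subseteq> ?anc t" by auto
  moreover have "t \<in> verts p" using t by (simp add: sink_def)
  ultimately have "card (verts p) \<le> vertex_tree_size p t"
    using le[of t] card_mono[of "?anc t" "verts p"] by auto
  moreover have "(THE v. sink p v) = t" using t t_unique by blast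
  ultimately show ?thesis by (simp add: tree_measure_def)
qed

lemma inj_fact_sentence: "inj fact_sentence"
proof (rule injI)
  show "f = g" if "fact_sentence f = fact_sentence g" for f g
    using that by (cases f; cases g) auto
qed

text \<open>Distinct facts have distinct sentences, so the facts that label vertices are at most as
  many as the vertices.\<close>

lemma few_facts_if_few_vertices:
  assumes p: "sk_proof T A q p" and "card (verts p) \<le> n"
  shows "\<exists>B\<subseteq>A. finite B \<and> card B \<le> n \<and> sk_proof T B q p"
proof -
  let ?B = "{f \<in> A. fact_sentence f \<in> lab p ` verts p}"
  have fin: "finite (verts p)" using p by (simp add: sk_proof_def proof_of_def)
  have inj: "inj_on fact_sentence ?B" using inj_fact_sentence by (rule inj_on_subset) simp
  have sub: "fact_sentence ` ?B \<subseteq> lab p ` verts p" by auto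
  have "card ?B = card (fact_sentence ` ?B)" using card_image[OF inj] by simp
  also have "\<dots> \<le> card (lab p ` verts p)" using sub fin by (intro card_mono) auto
  also have "\<dots> \<le> card (verts p)" by (rule card_image_le[OF fin])
  finally have "card ?B \<le> n" using assms(2) by simp
  moreover have "finite ?B"
    by (rule finite_imageD[OF finite_subset[OF sub finite_imageI[OF fin]] inj])
  moreover have "sk_proof T ?B q p" by (rule sk_proof_facts[OF p]) simp
  ultimately show ?thesis by (intro exI[of _ ?B]) auto
qed

text \<open>The number of vertices is not bounded by the domain size, and neither is the number of concept
  and role names in the leaves. But two names outside of \<open>N\<close> for which \<open>A\<close> has the same facts over
  the individuals of the proof can be identified, which leaves boundedly many.\<close>

lemma few_facts_if_small_domain:
  fixes p :: "('v, sentence) dstruct"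
  assumes p: "sk_proof T A q p" and n: "domain_measure p \<le> n"
    and N: "finite N" "\<And>\<phi>. \<phi> \<in> insert (CQ q) (skolem ` T) \<Longrightarrow> sentence_names \<phi> \<subseteq> N"
  shows "\<exists>B\<subseteq>A. \<exists>p' :: ('v, sentence) dstruct. finite B \<and>
      card B \<le> (card N + 2 ^ n) * n + (card N + 2 ^ (n * n)) * (n * n) \<and>
      sk_proof T B q p' \<and> domain_measure p' \<le> n"
proof -
  have fin: "finite (verts p)" using p by (simp add: sk_proof_def proof_of_def)
  define D where "D = (\<Union>v\<in>verts p. ground_terms_in (lab p v))"
  \<comment> \<open>Ground subterms count towards the domain, so individuals nested in Skolem terms
    are included and \<open>I\<close> has at most \<open>n\<close> elements.\<close>
  define I where "I = {a. Const a \<in> D}"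
  have finD: "finite D" unfolding D_def using fin finite_ground_terms_in by blast
  have im: "Const ` I \<subseteq> D" and inj: "inj_on Const I" by (auto simp: I_def inj_on_def)
  have finI: "finite I" by (rule finite_imageD[OF finite_subset[OF im finD] inj])
  have "card I \<le> card D" using card_image[OF inj] card_mono[OF finD im] by simp
  then have cI: "card I \<le> n" using n by (simp add: domain_measure_def D_def)
  define ctype where "ctype C = {a \<in> I. CFact C a \<in> A}" for C
  define rtype where "rtype r = {(a, b) \<in> I \<times> I. RFact r a b \<in> A}" for r
  \<comment> \<open>The choice depends only on the type, so at most \<open>2 ^ n\<close> images
    arise outside the case \<open>C \<in> N\<close>; for roles the types are sets of pairs, which
    gives \<open>2 ^ (n * n)\<close>. Names in \<open>N\<close> stay put to keep the rules and the
    query fixed.\<close>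
  define \<gamma> where "\<gamma> C = (if C \<in> N then C else SOME C'. ctype C' = ctype C)" for C
  define \<rho> where "\<rho> r = (if r \<in> N then r else SOME r'. rtype r' = rtype r)" for r
  have \<gamma>: "ctype (\<gamma> C) = ctype C" for C
    using someI[of "\<lambda>C'. ctype C' = ctype C" C] by (simp add: \<gamma>_def)
  have \<rho>: "rtype (\<rho> r) = rtype r" for r
    using someI[of "\<lambda>r'. rtype r' = rtype r" r] by (simp add: \<rho>_def)
  define CN where "CN = N \<union> (\<lambda>X. SOME C'. ctype C' = X) ` Pow I"
  define RN where "RN = N \<union> (\<lambda>X. SOME r'. rtype r' = X) ` Pow (I \<times> I)"
  have \<gamma>CN: "\<gamma> C \<in> CN" for C by (auto simp: \<gamma>_def CN_def ctype_def)
  have \<rho>RN: "\<rho> r \<in> RN" for r by (auto simp: \<rho>_def RN_def rtype_def)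
  have cCN: "card CN \<le> card N + 2 ^ n"
  proof -
    have "card CN \<le> card N + card ((\<lambda>X. SOME C'. ctype C' = X) ` Pow I)"
      unfolding CN_def by (rule card_Un_le)
    also have "\<dots> \<le> card N + card (Pow I)" using finI by (simp add: card_image_le)
    also have "\<dots> \<le> card N + 2 ^ n" using finI cI by (simp add: card_Pow)
    finally show ?thesis .
  qed
  have cII: "card (I \<times> I) \<le> n * n"
    using cI by (simp add: card_cartesian_product mult_le_mono)
  have cRN: "card RN \<le> card N + 2 ^ (n * n)"
  proof -
    have "card RN \<le> card N + card ((\<lambda>X. SOME r'. rtype r' = X) ` Pow (I \<times> I))"
      unfolding RN_def by (rule card_Un_le)
    also have "\<dots> \<le> card N + card (Pow (I \<times> I))" using finI by (simp add: card_image_le)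
    also have "\<dots> \<le> card N + 2 ^ (n * n)" using finI cII by (simp add: card_Pow)
    finally show ?thesis .
  qed
  have finN: "finite CN" "finite RN" using N(1) finI by (auto simp: CN_def RN_def)
  let ?F = "(\<lambda>(C, a). CFact C a) ` (CN \<times> I)" and ?G = "(\<lambda>(r, a, b). RFact r a b) ` (RN \<times> I \<times> I)"
  let ?B = "A \<inter> (?F \<union> ?G)"
  have "card ?B \<le> card (?F \<union> ?G)" using finN finI by (intro card_mono) auto
  also have "\<dots> \<le> card ?F + card ?G" by (rule card_Un_le)
  also have "\<dots> \<le> card (CN \<times> I) + card (RN \<times> I \<times> I)"
    using finN finI by (intro add_mono card_image_le) auto
  also have "\<dots> \<le> (card N + 2 ^ n) * n + (card N + 2 ^ (n * n)) * (n * n)"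
    unfolding card_cartesian_product[of CN] card_cartesian_product[of RN]
    using cCN cRN cI cII by (intro add_mono mult_mono) auto
  finally have card: "card ?B \<le> (card N + 2 ^ n) * n + (card N + 2 ^ (n * n)) * (n * n)" .
  have fixed: "rename_sentence \<gamma> \<rho> id \<phi> = \<phi>" if "\<phi> \<in> insert (CQ q) (skolem ` T)" for \<phi>
    using N(2)[OF that] by (intro rename_sentence_fixed) (auto simp: \<gamma>_def \<rho>_def)
  have "rename_fact \<gamma> \<rho> id f \<in> ?B" if f: "f \<in> A" "fact_sentence f \<in> lab p ` verts p" for f
  proof -
    have D: "ground_terms_in (fact_sentence f) \<subseteq> D" using f(2) by (auto simp: D_def)
    show ?thesis
    proof (cases f)
      case (CFact C a)
      then have "a \<in> I" using D by (auto simp: I_def ground_terms_in_def)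
      \<comment> \<open>\<open>C\<close> and its representative have the same type, so the renamed
        fact is already present in \<open>A\<close>.\<close>
      moreover have "CFact (\<gamma> C) a \<in> A" using \<gamma>[of C] f(1) CFact \<open>a \<in> I\<close> by (auto simp: ctype_def)
      ultimately show ?thesis using CFact \<gamma>CN by auto
    next
      case (RFact r a b)
      then have I: "a \<in> I" "b \<in> I" using D by (auto simp: I_def ground_terms_in_def)
      moreover have "RFact (\<rho> r) a b \<in> A" using \<rho>[of r] f(1) RFact I by (auto simp: rtype_def)
      moreover have "RFact (\<rho> r) a b \<in> ?G"
        using I \<rho>RN[of r] by (intro image_eqI[of _ _ "(\<rho> r, a, b)"]) auto
      ultimately show ?thesis using RFact by simp
    qed
  qed
  then have "sk_proof T ?B q (rename_proof \<gamma> \<rho> id p)"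
    using fixed by (intro sk_proof_rename[OF p]) (auto simp del: rename_sentence.simps)
  moreover have "domain_measure (rename_proof \<gamma> \<rho> id p) \<le> n"
    using domain_measure_rename[OF fin, of \<gamma> \<rho> id] n by simp
  moreover have "finite ?B" "?B \<subseteq> A" using finN finI by auto
  ultimately show ?thesis
    using card by blast
qed

theorem theorem1:
  fixes L :: "tbox set" and T :: tbox and q :: "atom list" and n :: nat
    and \<mm> :: "(nat, sentence) dstruct \<Rightarrow> nat"
  assumes "\<forall>T'\<in>L. finite T'"
    and "T \<in> L"
    and "boolean_cq q"
    and "\<mm> \<in> {size_measure, tree_measure, domain_measure}"
  shows "in_AC0 abox_words
           {A. finite A \<and> kb_entails T A q}
           {A. \<exists>p. sk_proof T A q p \<and> \<mm> p \<le> n}"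
proof -
  define N where "N = (\<Union>\<phi>\<in>insert (CQ q) (skolem ` T). sentence_names \<phi>)"
  have N: "finite N" using assms(1,2) finite_sentence_names by (auto simp: N_def)
  have sub: "sentence_names \<phi> \<subseteq> N" if "\<phi> \<in> insert (CQ q) (skolem ` T)" for \<phi>
    using that by (auto simp: N_def)
  \<comment> \<open>One bound for all three measures: the first summand serves size and tree size,
    the second the domain size.\<close>
  let ?K = "n + ((card N + 2 ^ n) * n + (card N + 2 ^ (n * n)) * (n * n))"
  show ?thesis
  proof (rule local_invariant_in_AC0[OF N])
    fix A B assume "A \<subseteq> B" "\<exists>p. sk_proof T A q p \<and> \<mm> p \<le> n"
    then show "\<exists>p. sk_proof T B q p \<and> \<mm> p \<le> n"
      using sk_proof_facts by blast
  next
    fix A assume "\<exists>p. sk_proof T A q p \<and> \<mm> p \<le> n"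
    then obtain p where p: "sk_proof T A q p" "\<mm> p \<le> n" by blast
    \<comment> \<open>The tree size dominates the number of vertices, so it shares the case of the
      size.\<close>
    consider "card (verts p) \<le> n" | "\<mm> = domain_measure"
      using assms(4) p card_verts_le_tree_measure[of _ _ p]
      by (fastforce simp: size_measure_def sk_proof_def)
    then show "\<exists>B\<subseteq>A. finite B \<and> card B \<le> ?K \<and> (\<exists>p. sk_proof T B q p \<and> \<mm> p \<le> n)"
    proof cases
      case 1
      then show ?thesis using few_facts_if_few_vertices[OF p(1)] p(2) by (meson trans_le_add1)
    next
      case 2
      then show ?thesis
        using few_facts_if_small_domain[OF p(1) _ N sub, of n] p(2) by (meson trans_le_add2)
    qed
  next
    fix \<pi> A assume \<pi>: "inj \<pi>" "\<forall>c\<in>N. \<pi> c = c" and "\<exists>p. sk_proof T A q p \<and> \<mm> p \<le> n"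
    then obtain p where p: "sk_proof T A q p" "\<mm> p \<le> n" by blast
    have "rename_sentence \<pi> \<pi> \<pi> \<phi> = \<phi>" if "\<phi> \<in> insert (CQ q) (skolem ` T)" for \<phi>
      using sub[OF that] \<pi>(2) by (intro rename_sentence_fixed) auto
    then have "sk_proof T (rename_fact \<pi> \<pi> \<pi> ` A) q (rename_proof \<pi> \<pi> \<pi> p)"
      using \<pi>(1) by (intro sk_proof_rename[OF p(1)]) (auto simp del: rename_sentence.simps)
    moreover have "finite (verts p)" using p(1) by (simp add: sk_proof_def proof_of_def)
    then have "\<mm> (rename_proof \<pi> \<pi> \<pi> p) \<le> n"
      using p(2) assms(4) domain_measure_rename[of p \<pi> \<pi> \<pi>] by auto
    ultimately show "\<exists>p. sk_proof T (rename_fact \<pi> \<pi> \<pi> ` A) q p \<and> \<mm> p \<le> n" by blast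
  qed
qed

end
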